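(* (Infrastructure distance formula.) Let $N\equiv 1\pmod 4$ be a positive integer that is not a perfect square; all forms below are reduced integral binary quadratic forms of discriminant $N$, except for the compositions $F_1*G_1$ and $F_k*G_\ell$, which need not be reduced. If $F_1\sim F_k$ are equivalent forms and $G_1\sim G_\ell$ are equivalent forms, $D_{\rho,1}$ is the reduction distance for $F_1*G_1$, $D_{\rho,2}$ is the reduction distance for $F_k*G_\ell$, and $m_1$ and $m_2$ are the factors cancelled in the compositions $F_1*G_1$ and $F_k*G_\ell$ respectively, then (distances being considered modulo the regulator $R$) $$D(F_1\#G_1,\,F_k\#G_\ell)=D(F_1,F_k)+D(G_1,G_\ell)+D_{\rho,2}-D_{\rho,1}+\log(m_2/m_1).$$
   Context: Forms. $(a,b,c)$ denotes $ax^2+bxy+cy^2$ with $a,b,c\in\mathbb{Z}$ and discriminant $b^2-4ac=N$; it is reduced if $|\sqrt{N}-2|a||<b<\sqrt{N}$. The relation $f\sim g$ (proper equivalence) means that $g$ is obtained from $f$ by a substitution $(x,y)\mapsto(sx+ty,ux+vy)$ with $\begin{pmatrix} s & t \\ u & v \end{pmatrix}\in SL_2(\mathbb{Z})$. Composition. For forms $(a_1,b_1,c_1),(a_2,b_2,c_2)$ of discriminant $N$, let $m=\gcd\left(a_1,a_2,\frac{b_1+b_2}{2}\right)$ (the factor cancelled in the composition) and let $B$ be the integer of smallest absolute value solving simultaneously, modulo $2a_1a_2$, $$a_2mB\equiv mb_1a_2,\qquad a_1mB\equiv mb_2a_1,\qquad \tfrac{b_1+b_2}{2}mB\equiv m\tfrac{b_1b_2+N}{2}.$$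 Then $(a_1,b_1,c_1)*(a_2,b_2,c_2)=\left(\frac{a_1a_2}{m^2},B,\frac{(B^2-N)m^2}{4a_1a_2}\right)$. For reduced forms $f,g$, $f\#g$ denotes the reduced form, properly equivalent to $f*g$, obtained by applying the reduction algorithm to $f*g$ (repeatedly applying the substitutions $\begin{pmatrix} 1 & n \\ 0 & 1 \end{pmatrix}$, $n\in\mathbb{Z}$, and $\begin{pmatrix} 0 & -1 \\ 1 & 0 \end{pmatrix}$ until a reduced form is reached). Distance. Let $\{x_i\}$ be the complete quotients in a simple continued fraction expansion, $x_{i+1}=1/(x_i-\lfloor x_i\rfloor)$, each written as $x_i=\frac{\sqrt{N}+P}{Q}$ with positive integers $P,Q$ depending on $i$. For $m<n$ the infrastructure distance is $$D(x_m,x_n)=\log\left(\prod_{k=m+1}^{n}x_k\right).$$ A form $F$ corresponds to a term $x=\frac{\sqrt{N}+P}{Q}$ via $x\mapsto f_+=\left(\frac{Q}{2},P,\frac{P^2-N}{2Q}\right)$, and if $F_m,F_n$ correspond to $x_m,x_n$ one writes $D(F_m,F_n)$ for $D(x_m,x_n)$. Distances are considered modulo the regulator $R$, the distance around the principal cycle (the cycle of reduced forms equivalent to the identity $(1,b,c)$ for composition): $R=D(F_0,F_\pi)$, where $\pi$ is the period of the principal cycle. Reduction distance. Forms correspond in the usual way to ideals in the quadratic order of discriminant $N$; for an ideal $I$, $L(I)$ denotes the least positive integer contained in it. For any primitive ideal $I$ there exist a reduced ideal $I_k$ (one corresponding to a reduced form) and $\theta_k\in I$ such that $(L(I)\theta_k)I_k=(L(I_k))I$;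 here $\theta_k$ may be computed by continued fractions (or Voronoi's method). The reduction distance is $D_\rho=-\log(\theta_k)$, considered as the distance from $I$ to $I_k$. The reduction distance for $f*g$ is this quantity with $I$ the ideal corresponding to $f*g$ and $I_k$ the ideal corresponding to $f\#g$.
   Formalization: The forms F_1 and G_1 (hence F_k and G_ℓ) are additionally assumed primitive; for imprimitive forms the distance is not well defined modulo R, e.g. N=45, G=(3,3,-3), where D(G,G) takes every value n·log((1+√5)/2) while R=4·log((1+√5)/2). *)

theory Defs
  imports
    Complex_Main
    "HOL-Number_Theory.Cong"
    "HOL-Computational_Algebra.Nth_Powers"
    "HOL-Library.Real_Mod"
begin

text \<open>The triple \<open>(a, b, c)\<close> stands for the form \<open>a x\<^sup>2 + b x y + c y\<^sup>2\<close>.\<close>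

type_synonym form = "int \<times> int \<times> int"

fun form_eval :: "form \<Rightarrow> int \<Rightarrow> int \<Rightarrow> int" where
  "form_eval (a, b, c) x y = a * x^2 + b * x * y + c * y^2"

fun disc :: "form \<Rightarrow> int" where
  "disc (a, b, c) = b^2 - 4 * a * c"

fun primitive_form :: "form \<Rightarrow> bool" where
  "primitive_form (a, b, c) \<longleftrightarrow> gcd a (gcd b c) = 1"

fun reduced :: "int \<Rightarrow> form \<Rightarrow> bool" where
  "reduced N (a, b, c) \<longleftrightarrow>
     \<bar>sqrt (of_int N) - 2 * \<bar>of_int a\<bar>\<bar> < of_int b \<and> of_int b < sqrt (of_int N)"

definition is_subst :: "int \<Rightarrow> int \<Rightarrow> int \<Rightarrow> int \<Rightarrow> form \<Rightarrow> form \<Rightarrow> bool" where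
  "is_subst s t u v f g \<longleftrightarrow>
     (\<forall>x y. form_eval g x y = form_eval f (s * x + t * y) (u * x + v * y))"

definition properly_equivalent :: "form \<Rightarrow> form \<Rightarrow> bool" where
  "properly_equivalent f g \<longleftrightarrow> (\<exists>s t u v. s * v - t * u = 1 \<and> is_subst s t u v f g)"


subsection \<open>Composition and reduction\<close>

fun comp_factor :: "form \<Rightarrow> form \<Rightarrow> int" where
  "comp_factor (a1, b1, c1) (a2, b2, c2) = gcd a1 (gcd a2 ((b1 + b2) div 2))"

fun comp_middle :: "int \<Rightarrow> form \<Rightarrow> form \<Rightarrow> int \<Rightarrow> bool" where
  "comp_middle N (a1, b1, c1) (a2, b2, c2) B \<longleftrightarrow>
     (let m = comp_factor (a1, b1, c1) (a2, b2, c2) in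
        [a2 * m * B = m * b1 * a2] (mod (2 * a1 * a2)) \<and>
        [a1 * m * B = m * b2 * a1] (mod (2 * a1 * a2)) \<and>
        [(b1 + b2) div 2 * m * B = m * ((b1 * b2 + N) div 2)] (mod (2 * a1 * a2)))"

text \<open>Composition is a relation because the solution \<open>B\<close> of smallest absolute value is determined
  only up to sign when \<open>B\<close> and \<open>-B\<close> are both solutions. For odd \<open>N\<close> all the divisions by 2
  are exact, since \<open>b1\<close> and \<open>b2\<close> are odd.\<close>

fun is_composition :: "int \<Rightarrow> form \<Rightarrow> form \<Rightarrow> form \<Rightarrow> bool" where
  "is_composition N (a1, b1, c1) (a2, b2, c2) h \<longleftrightarrow>
     (\<exists>B. comp_middle N (a1, b1, c1) (a2, b2, c2) B \<and>
          (\<forall>B'. comp_middle N (a1, b1, c1) (a2, b2, c2) B' \<longrightarrow> \<bar>B\<bar> \<le> \<bar>B'\<bar>) \<and>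
          (let m = comp_factor (a1, b1, c1) (a2, b2, c2) in
             h = ((a1 * a2) div m^2, B, ((B^2 - N) * m^2) div (4 * a1 * a2))))"

text \<open>\<open>reduces_to N f h\<close>: some run of the reduction algorithm, started at \<open>f\<close>, stops at \<open>h\<close>.
  No strategy for choosing the substitutions is fixed, so \<open>h\<close> is not unique.\<close>

inductive reduces_to :: "int \<Rightarrow> form \<Rightarrow> form \<Rightarrow> bool" for N where
  stop: "reduced N f \<Longrightarrow> reduces_to N f f"
| shift: "\<not> reduced N f \<Longrightarrow> is_subst 1 n 0 1 f g \<Longrightarrow> reduces_to N g h \<Longrightarrow> reduces_to N f h"
| swap: "\<not> reduced N f \<Longrightarrow> is_subst 0 (- 1) 1 0 f g \<Longrightarrow> reduces_to N g h \<Longrightarrow> reduces_to N f h"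


subsection \<open>Infrastructure distance\<close>

fun complete_quotient :: "real \<Rightarrow> nat \<Rightarrow> real" where
  "complete_quotient x 0 = x"
| "complete_quotient x (Suc i) =
     1 / (complete_quotient x i - of_int \<lfloor>complete_quotient x i\<rfloor>)"

definition cf_distance :: "real \<Rightarrow> nat \<Rightarrow> nat \<Rightarrow> real" where
  "cf_distance x m n = ln (\<Prod>k\<in>{m<..n}. complete_quotient x k)"

text \<open>The term \<open>(\<surd>N + P) / Q\<close> with \<open>P, Q > 0\<close> corresponding to a form: for \<open>a > 0\<close> the form is
  \<open>(Q/2, P, (P\<^sup>2 - N)/(2Q))\<close>, so \<open>Q = 2a\<close> and \<open>P = b\<close>. Along a cycle of reduced forms the sign
  of \<open>a\<close> alternates; a form with \<open>a < 0\<close> is \<open>(-Q/2, P, (N - P\<^sup>2)/(2Q))\<close>, so \<open>Q = 2\<bar>a\<bar>\<close>.\<close>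

fun form_term :: "int \<Rightarrow> form \<Rightarrow> real" where
  "form_term N (a, b, c) = (sqrt (of_int N) + of_int b) / (2 * \<bar>of_int a\<bar>)"

text \<open>\<open>d\<close> is a value of \<open>D(F, G)\<close>. Complete quotients of reduced forms recur periodically, so there
  are many values; for primitive forms they agree modulo the regulator.\<close>

definition is_distance :: "int \<Rightarrow> form \<Rightarrow> form \<Rightarrow> real \<Rightarrow> bool" where
  "is_distance N F G d \<longleftrightarrow>
     (\<exists>x m n. m < n \<and> complete_quotient x m = form_term N F \<and>
              complete_quotient x n = form_term N G \<and> d = cf_distance x m n)"

definition principal_form :: "int \<Rightarrow> form" where
  "principal_form N = (THE F. \<exists>b c. F = (1, b, c) \<and> disc F = N \<and> reduced N F)"

definition principal_period :: "int \<Rightarrow> nat" where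
  "principal_period N =
     (LEAST p. p > 0 \<and> complete_quotient (form_term N (principal_form N)) p
                         = form_term N (principal_form N))"

definition regulator :: "int \<Rightarrow> real" where
  "regulator N = cf_distance (form_term N (principal_form N)) 0 (principal_period N)"


subsection \<open>Reduction distance\<close>

text \<open>The ideal \<open>a\<int> + ((b + \<surd>N)/2)\<int>\<close>, as a set of real numbers. The sign of \<open>\<surd>N\<close> is the one
  for which it equals \<open>\<bar>a\<bar> (\<int> + x\<int>)\<close> with \<open>x = form_term N (a, b, c)\<close>.\<close>

fun form_ideal :: "int \<Rightarrow> form \<Rightarrow> real set" where
  "form_ideal N (a, b, c) =
     {of_int u * of_int a + of_int v * ((of_int b + sqrt (of_int N)) / 2) | u v. True}"

definition least_pos_int :: "real set \<Rightarrow> nat" where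
  "least_pos_int I = (LEAST n. n > 0 \<and> real n \<in> I)"

text \<open>The relation \<open>(L(I) \<theta>) J = (L(J)) I\<close> makes \<open>L(I) \<theta>\<close>, though not always \<open>\<theta>\<close>, an element
  of \<open>I\<close>. It determines \<open>\<theta>\<close> up to units.\<close>

definition is_reduction_distance :: "real set \<Rightarrow> real set \<Rightarrow> real \<Rightarrow> bool" where
  "is_reduction_distance I J d \<longleftrightarrow>
     (\<exists>\<theta>>0. (\<lambda>z. real (least_pos_int I) * \<theta> * z) ` J = (\<lambda>z. real (least_pos_int J) * z) ` I \<and>
            d = - ln \<theta>)"

end

theory Submission
  imports Defs
begin

text \<open>To a form \<open>F\<close> attach the module \<open>M\<^sub>F = \<int> + x\<int>\<close>, where \<open>x\<close> is its term. A continued fraction step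
  rescales this module by the new complete quotient, so \<open>M\<^sub>G = e\<^sup>d M\<^sub>F\<close> for every value \<open>d\<close> of
  \<open>D(F, G)\<close>; likewise \<open>M\<^sub>H = e\<^sup>r M\<^sub>C\<close> if \<open>r\<close> is a reduction distance from \<open>C\<close> to \<open>H\<close>, and
  \<open>M\<^sub>C = m M\<^sub>F M\<^sub>G\<close> if \<open>C\<close> is the composition of \<open>F\<close> and \<open>G\<close> with cancelled factor \<open>m\<close>.
  Multiplying these relations, the modules of \<open>H1\<close> and \<open>H2\<close> differ by \<open>e\<^sup>D\<close> with \<open>D\<close> the right-hand
  side of the formula. Any other scaling between them differs by a positive unit of the order
  because the modules are invertible. Finally, the minima of \<open>M\<^sub>F\<close> in \<open>(0, 1]\<close> for a reduced \<open>F\<close> are exactly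
  the reciprocals of the partial products of complete quotients. Hence a reduced number whose module
  is a multiple of \<open>M\<^sub>F\<close> lies on the cycle of \<open>F\<close>, and every positive unit is a power of \<open>e\<^sup>R\<close>.\<close>

subsection \<open>Continued fractions and rank-two modules\<close>

lemma sqrt_int_irrational:
  fixes N :: int
  assumes "N > 0" "\<not> is_square N"
  shows "sqrt (of_int N) \<notin> \<rat>"
proof
  assume "sqrt (of_int N) \<in> \<rat>"
  then obtain m n :: nat where n: "n \<noteq> 0" and mn: "\<bar>sqrt (of_int N)\<bar> = real m / real n"
    and co: "coprime m n"
    by (rule Rats_abs_nat_div_natE)
  have "sqrt (of_int N) * real n = real m"
    using mn n assms(1) by (simp add: field_simps)
  then have "(sqrt (of_int N) * real n)\<^sup>2 = (real m)\<^sup>2"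
    by simp
  then have "real_of_int (N * (int n)\<^sup>2) = real_of_int ((int m)\<^sup>2)"
    using assms(1) by (simp add: power_mult_distrib)
  then have eq: "N * (int n)\<^sup>2 = (int m)\<^sup>2"
    by (simp only: of_int_eq_iff)
  then have "(int n)\<^sup>2 dvd (int m)\<^sup>2"
    by (metis dvd_triv_right)
  then have "int n dvd int m"
    by simp
  then have "n = 1"
    using co by (metis coprime_absorb_right coprime_commute int_dvd_int_iff is_unit_gcd nat_dvd_1_iff_1 gcd_nat.orderE)
  then have "N = (int m)\<^sup>2"
    using eq by simp
  then show False
    using assms(2) by auto
qed

abbreviation scal :: "real \<Rightarrow> real set \<Rightarrow> real set" where
  "scal c A \<equiv> (\<lambda>z. c * z) ` A"

lemma scal_scal: "scal c (scal d A) = scal (c * d) A"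
  by (simp add: image_image mult.assoc)

lemma scal_cancel:
  assumes "c \<noteq> 0" "scal c A = scal d B" shows "A = scal (d / c) B"
proof -
  have "A = scal (1 / c) (scal c A)" by (subst scal_scal) (use assms(1) in simp)
  also have "\<dots> = scal (1 / c) (scal d B)" by (simp only: assms(2))
  also have "\<dots> = scal (d / c) B" by (subst scal_scal) simp
  finally show ?thesis .
qed

definition lat :: "real \<Rightarrow> real set" where
  "lat x = {of_int u + of_int v * x | u v. True}"

lemma latI: "of_int u + of_int v * x \<in> lat x"
  by (auto simp: lat_def)

lemma latE:
  assumes "z \<in> lat x" obtains u v where "z = of_int u + of_int v * x"
  using assms by (auto simp: lat_def)

lemma one_in_lat: "1 \<in> lat x"
  using latI[of 1 0 x] by simp

lemma lat_shift: "lat (x - of_int n) = lat x"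
proof (intro equalityI subsetI)
  fix z assume "z \<in> lat (x - of_int n)"
  then obtain u v where "z = of_int u + of_int v * (x - of_int n)" by (rule latE)
  then have "z = of_int (u - v * n) + of_int v * x" by (simp add: algebra_simps)
  then show "z \<in> lat x" by (simp only: latI)
next
  fix z assume "z \<in> lat x"
  then obtain u v where "z = of_int u + of_int v * x" by (rule latE)
  then have "z = of_int (u + v * n) + of_int v * (x - of_int n)" by (simp add: algebra_simps)
  then show "z \<in> lat (x - of_int n)" by (simp only: latI)
qed

text \<open>Inversion exchanges the generators \<open>1\<close> and \<open>x\<close> up to the
  factor \<open>1 / x\<close>. Together with \<open>lat_shift\<close> this covers one continued
  fraction step.\<close>

lemma lat_inverse:
  assumes "x \<noteq> 0" shows "lat (1 / x) = scal (1 / x) (lat x)"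
proof (intro equalityI subsetI)
  fix z assume "z \<in> lat (1 / x)"
  then obtain u v where "z = of_int u + of_int v * (1 / x)" by (rule latE)
  then have "z = 1 / x * (of_int v + of_int u * x)" using assms by (simp add: field_simps)
  then show "z \<in> scal (1 / x) (lat x)" using latI by blast
next
  fix z assume "z \<in> scal (1 / x) (lat x)"
  then obtain w where w: "w \<in> lat x" "z = 1 / x * w" by blast
  then obtain u v where "w = of_int u + of_int v * x" by (blast elim: latE)
  then have "z = of_int v + of_int u * (1 / x)" using w assms by (simp add: field_simps)
  then show "z \<in> lat (1 / x)" by (simp only: latI)
qed

section \<open>Partial products of complete quotients\<close>

lemma complete_quotient_add:
  "complete_quotient x (m + n) = complete_quotient (complete_quotient x m) n"
  by (induction n) simp_all

text \<open>The factor of index 0 is left out, as in \<open>cf_distance\<close>, so that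
  \<open>ln (cf_prod x n)\<close> is the distance from \<open>x\<close> to its \<open>n\<close>-th
  complete quotient.\<close>

definition cf_prod :: "real \<Rightarrow> nat \<Rightarrow> real" where
  "cf_prod x n = (\<Prod>k\<in>{0<..n}. complete_quotient x k)"

lemma cf_prod_0 [simp]: "cf_prod x 0 = 1"
  by (simp add: cf_prod_def)

lemma cf_prod_Suc: "cf_prod x (Suc n) = cf_prod x n * complete_quotient x (Suc n)"
proof -
  have "{0<..Suc n} = insert (Suc n) {0<..n}" by auto
  then show ?thesis by (simp add: cf_prod_def del: complete_quotient.simps)
qed

lemma cf_distance_eq:
  assumes "m \<le> n"
  shows "cf_distance x m n = ln (cf_prod (complete_quotient x m) (n - m))"
proof -
  have "(\<Prod>k\<in>{m<..n}. complete_quotient x k) =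
        (\<Prod>k\<in>{0<..n - m}. complete_quotient x (m + k))"
    by (rule prod.reindex_bij_witness[of _ "\<lambda>k. m + k" "\<lambda>k. k - m"]) auto
  then show ?thesis by (simp add: cf_distance_def cf_prod_def complete_quotient_add)
qed

subsection \<open>Reduced quadratic irrationals\<close>

locale real_quadratic =
  fixes N :: int
  assumes N_pos: "N > 0" and N_nonsquare: "\<not> is_square N"
begin

abbreviation s :: real where "s \<equiv> sqrt (of_int N)"

lemma s_irrational: "s \<notin> \<rat>"
  using sqrt_int_irrational N_pos N_nonsquare by blast

lemma s_sq: "s * s = of_int N"
  using N_pos by simp

lemma rep_unique:
  assumes "p \<in> \<rat>" "q \<in> \<rat>" "p' \<in> \<rat>" "q' \<in> \<rat>" "p + q * s = p' + q' * s"
  shows "p = p' \<and> q = q'"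
proof -
  have "q = q'"
  proof (rule ccontr)
    assume "q \<noteq> q'"
    then have "s = (p' - p) / (q - q')" using assms(5) by (simp add: field_simps)
    moreover have "(p' - p) / (q - q') \<in> \<rat>" using assms by simp
    ultimately show False using s_irrational by simp
  qed
  then show ?thesis using assms(5) by simp
qed

section \<open>The quadratic field and its conjugation\<close>

definition K :: "real set" where
  "K = {p + q * s | p q. p \<in> \<rat> \<and> q \<in> \<rat>}"

text \<open>The field is a set of reals and not a type, so conjugation is given by a description. By
  \<open>rep_unique\<close> it is well defined on \<open>K\<close>; elsewhere its value is
  unspecified.\<close>

definition qconj :: "real \<Rightarrow> real" where
  "qconj z = (THE w. \<exists>p\<in>\<rat>. \<exists>q\<in>\<rat>. z = p + q * s \<and> w = p - q * s)"

lemma qconj_rep: "p \<in> \<rat> \<Longrightarrow> q \<in> \<rat> \<Longrightarrow> qconj (p + q * s) = p - q * s"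
  unfolding qconj_def by (rule the_equality) (use rep_unique in blast)+

lemma KI: "p \<in> \<rat> \<Longrightarrow> q \<in> \<rat> \<Longrightarrow> p + q * s \<in> K"
  by (auto simp: K_def)

lemma KE:
  assumes "z \<in> K" obtains p q where "p \<in> \<rat>" "q \<in> \<rat>" "z = p + q * s" "qconj z = p - q * s"
  using assms qconj_rep by (auto simp: K_def)

lemma K_rat: "z \<in> \<rat> \<Longrightarrow> z \<in> K" and qconj_rat: "z \<in> \<rat> \<Longrightarrow> qconj z = z"
  using KI[of z 0] qconj_rep[of z 0] by auto

lemma K_add: "z \<in> K \<Longrightarrow> w \<in> K \<Longrightarrow> z + w \<in> K"
  and qconj_add: "z \<in> K \<Longrightarrow> w \<in> K \<Longrightarrow> qconj (z + w) = qconj z + qconj w"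
proof -
  assume "z \<in> K" "w \<in> K"
  then obtain p q p' q' where *: "p \<in> \<rat>" "q \<in> \<rat>" "p' \<in> \<rat>" "q' \<in> \<rat>" "z = p + q * s" "qconj z = p - q * s"
    "w = p' + q' * s" "qconj w = p' - q' * s" by (metis KE)
  have "z + w = (p + p') + (q + q') * s" using * by (simp add: algebra_simps)
  moreover have "p + p' \<in> \<rat>" "q + q' \<in> \<rat>" using * by auto
  ultimately show "z + w \<in> K" "qconj (z + w) = qconj z + qconj w"
    using KI[of "p + p'" "q + q'"] qconj_rep[of "p + p'" "q + q'"] *
    by (simp_all add: algebra_simps)
qed

lemma K_mult: "z \<in> K \<Longrightarrow> w \<in> K \<Longrightarrow> z * w \<in> K"
  and qconj_mult: "z \<in> K \<Longrightarrow> w \<in> K \<Longrightarrow> qconj (z * w) = qconj z * qconj w"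
proof -
  assume "z \<in> K" "w \<in> K"
  then obtain p q p' q' where *: "p \<in> \<rat>" "q \<in> \<rat>" "p' \<in> \<rat>" "q' \<in> \<rat>" "z = p + q * s" "qconj z = p - q * s"
    "w = p' + q' * s" "qconj w = p' - q' * s" by (metis KE)
  define a b where "a = p * p' + q * q' * of_int N" and "b = p * q' + q * p'"
  have "z * w = p * p' + q * q' * (s * s) + b * s"
    unfolding *(5,7) b_def by algebra
  then have 1: "z * w = a + b * s"
    unfolding s_sq by (simp add: a_def)
  have "qconj z * qconj w = p * p' + q * q' * (s * s) - b * s"
    unfolding *(6,8) b_def by algebra
  then have 2: "qconj z * qconj w = a - b * s"
    unfolding s_sq by (simp add: a_def)
  have "a \<in> \<rat>" "b \<in> \<rat>" using * by (auto simp: a_def b_def)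
  then show "z * w \<in> K" "qconj (z * w) = qconj z * qconj w"
    unfolding 1 2 using KI qconj_rep by auto
qed

lemma qconj_eq_0_iff: "z \<in> K \<Longrightarrow> qconj z = 0 \<longleftrightarrow> z = 0"
proof -
  assume "z \<in> K"
  then obtain p q where *: "p \<in> \<rat>" "q \<in> \<rat>" "z = p + q * s" "qconj z = p - q * s" by (rule KE)
  show ?thesis
    using rep_unique[of p q 0 0] rep_unique[of p "- q" 0 0] * by auto
qed

lemma K_inverse: assumes z: "z \<in> K" shows "1 / z \<in> K"
proof (cases "z = 0")
  case False
  obtain p q where *: "p \<in> \<rat>" "q \<in> \<rat>" "z = p + q * s" "qconj z = p - q * s" using z by (rule KE)
  have "z * qconj z = p * p - q * q * (s * s)" unfolding *(4) unfolding *(3) by algebra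
  then have n: "z * qconj z = p * p - q * q * of_int N" unfolding s_sq .
  define n where "n = p * p - q * q * of_int N"
  have zn: "z * qconj z = n" using n by (simp add: n_def)
  then have "n \<noteq> 0" using qconj_eq_0_iff[OF z] False by auto
  then have "1 / z = qconj z / n" using False zn by (simp add: field_simps)
  also have "\<dots> = p / n + (- q / n) * s" unfolding *(4) by (simp add: diff_divide_distrib)
  finally show ?thesis using KI[of "p / n" "- q / n"] * by (simp add: n_def)
qed (use K_rat in auto)

lemma qconj_inverse: assumes z: "z \<in> K" shows "qconj (1 / z) = 1 / qconj z"
proof (cases "z = 0")
  case False
  have "qconj (z * (1 / z)) = qconj z * qconj (1 / z)"
    using qconj_mult[OF z K_inverse[OF z]] .
  then show ?thesis using False qconj_eq_0_iff[OF z] qconj_rat[of 1] by (simp add: field_simps)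
qed (use qconj_rat[of 0] in simp)

lemma K_lin: "x \<in> K \<Longrightarrow> of_int u + of_int v * x \<in> K"
  by (intro K_add K_mult) (simp_all add: K_rat)

lemma qconj_lin: "x \<in> K \<Longrightarrow> qconj (of_int u + of_int v * x) = of_int u + of_int v * qconj x"
  by (simp add: qconj_add qconj_mult K_mult K_rat qconj_rat)

lemma qconj_shift: "x \<in> K \<Longrightarrow> qconj (x - of_int n) = qconj x - of_int n"
  using qconj_lin[of x "- n" 1] by simp

lemma lat_K: "x \<in> K \<Longrightarrow> z \<in> lat x \<Longrightarrow> z \<in> K"
  by (auto elim!: latE intro: K_lin)

text \<open>Galois's condition, which characterizes the purely periodic continued fractions.\<close>

definition reduced_number :: "real \<Rightarrow> bool" where
  "reduced_number x \<longleftrightarrow> x \<in> K \<and> x > 1 \<and> -1 < qconj x \<and> qconj x < 0"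

lemma reduced_numberD:
  assumes "reduced_number x" shows "x \<in> K" "x > 1" "-1 < qconj x" "qconj x < 0"
  using assms by (auto simp: reduced_number_def)

text \<open>An integer is its own conjugate, whereas \<open>x\<close> and \<open>qconj x\<close>
  have opposite signs. Hence a continued fraction step never divides by zero.\<close>

lemma reduced_number_frac:
  assumes "reduced_number x" shows "x - of_int \<lfloor>x\<rfloor> > 0"
proof -
  note x = reduced_numberD[OF assms]
  have "x \<noteq> of_int \<lfloor>x\<rfloor>"
  proof
    assume e: "x = of_int \<lfloor>x\<rfloor>"
    have "qconj (of_int \<lfloor>x\<rfloor>) = of_int \<lfloor>x\<rfloor>" by (rule qconj_rat) simp
    then show False using x by (simp flip: e)
  qed
  then show ?thesis using of_int_floor_le[of x] by linarith
qed

text \<open>The floor of \<open>x\<close> is at least 1, so the shifted conjugate lies below -1 and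
  its reciprocal lies between -1 and 0.\<close>

lemma reduced_number_step:
  assumes "reduced_number x" shows "reduced_number (1 / (x - of_int \<lfloor>x\<rfloor>))"
proof -
  note x = reduced_numberD[OF assms]
  define n where "n = \<lfloor>x\<rfloor>"
  have n: "n \<ge> 1" "x - of_int n > 0" "x - of_int n < 1"
    using x reduced_number_frac[OF assms] by (simp_all add: n_def) linarith
  have k: "x - of_int n \<in> K" using K_lin[of x "- n" 1] x by simp
  have c: "qconj (1 / (x - of_int n)) = 1 / (qconj x - of_int n)"
    using qconj_inverse[OF k] qconj_shift x by simp
  have "qconj x - of_int n < - 1" using x n by (smt (verit) of_int_1_le_iff)
  then have "-1 < 1 / (qconj x - of_int n)" "1 / (qconj x - of_int n) < 0"
    by (simp_all add: field_simps)
  then show ?thesis using n k c K_inverse by (simp add: reduced_number_def n_def)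
qed

lemma reduced_number_cq: "reduced_number x \<Longrightarrow> reduced_number (complete_quotient x n)"
  by (induction n) (simp_all add: reduced_number_step)

lemma cq_gt_1: "reduced_number x \<Longrightarrow> complete_quotient x n > 1"
  using reduced_number_cq reduced_numberD(2) by blast

lemma cf_prod_pos: "reduced_number x \<Longrightarrow> cf_prod x n > 0"
  unfolding cf_prod_def by (rule prod_pos) (use cq_gt_1 less_trans zero_less_one in blast)

lemma cf_prod_less_Suc: "reduced_number x \<Longrightarrow> cf_prod x n < cf_prod x (Suc n)"
  using cq_gt_1[of x "Suc n"] cf_prod_pos[of x n]
  by (simp add: cf_prod_Suc del: complete_quotient.simps)

lemma cf_prod_strict_mono: "reduced_number x \<Longrightarrow> strict_mono (cf_prod x)"
  by (simp add: strict_mono_Suc_iff cf_prod_less_Suc)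

text \<open>A single complete quotient may be close to 1, so growth is measured over two steps: the
  product of two consecutive ones, \<open>?y\<close> and \<open>?z\<close>, is
  \<open>\<lfloor>?y\<rfloor> * ?z + 1\<close>, which is at least 2.\<close>

lemma cf_prod_unbounded:
  assumes "reduced_number x" shows "cf_prod x (2 * n) \<ge> 2 ^ n"
proof (induction n)
  case (Suc n)
  let ?y = "complete_quotient x (Suc (2 * n))"
  let ?z = "complete_quotient x (Suc (Suc (2 * n)))"
  have y: "reduced_number ?y" by (rule reduced_number_cq[OF assms])
  have f: "?y - of_int \<lfloor>?y\<rfloor> > 0" by (rule reduced_number_frac[OF y])
  have "?z = 1 / (?y - of_int \<lfloor>?y\<rfloor>)" by simp
  then have "(?y - of_int \<lfloor>?y\<rfloor>) * ?z = 1" using f by simp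
  then have "?y * ?z = of_int \<lfloor>?y\<rfloor> * ?z + 1" by (simp only: algebra_simps)
  moreover have "\<lfloor>?y\<rfloor> \<ge> 1" using cq_gt_1[OF assms, of "Suc (2 * n)"] by (simp only: le_floor_iff)
  then have "of_int \<lfloor>?y\<rfloor> * ?z \<ge> 1 * ?z"
    using cq_gt_1[OF assms, of "Suc (Suc (2 * n))"] by (intro mult_right_mono) simp_all
  ultimately have "?y * ?z \<ge> 2" using cq_gt_1[OF assms, of "Suc (Suc (2 * n))"] by linarith
  then have "cf_prod x (2 * n) * (?y * ?z) \<ge> 2 ^ n * 2"
    using Suc.IH by (intro mult_mono) (use cf_prod_pos[OF assms, of "2 * n"] in auto)
  moreover have "cf_prod x (2 * Suc n) = cf_prod x (2 * n) * (?y * ?z)"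
    by (simp add: cf_prod_Suc mult.assoc del: complete_quotient.simps)
  ultimately show ?case by simp
qed simp

lemma lat_cq:
  assumes "reduced_number x"
  shows "lat (complete_quotient x n) = scal (cf_prod x n) (lat x)"
proof (induction n)
  case (Suc n)
  let ?y = "complete_quotient x n"
  have f: "?y - of_int \<lfloor>?y\<rfloor> > 0" by (rule reduced_number_frac[OF reduced_number_cq[OF assms]])
  have "lat (complete_quotient x (Suc n)) = scal (complete_quotient x (Suc n)) (lat ?y)"
    using lat_inverse[of "?y - of_int \<lfloor>?y\<rfloor>"] f lat_shift by simp
  also have "\<dots> = scal (complete_quotient x (Suc n) * cf_prod x n) (lat x)"
    by (simp only: Suc scal_scal)
  finally show ?case by (simp only: cf_prod_Suc mult.commute)
qed simp

text \<open>The positive numbers \<open>x - qconj x\<close> and \<open>y - qconj y\<close> are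
  integer multiples of each other, which forces \<open>v = 1\<close>. Then \<open>u\<close> is a
  difference of two numbers in (-1, 0), hence 0.\<close>

lemma reduced_number_eqI:
  assumes "reduced_number x" "reduced_number y" "lat x = lat y"
  shows "x = y"
proof -
  note x = reduced_numberD[OF assms(1)] and y = reduced_numberD[OF assms(2)]
  have "x \<in> lat y" "y \<in> lat x" using assms(3) latI[of 0 1 x] latI[of 0 1 y] by auto
  then obtain u v u' v' where uv: "x = of_int u + of_int v * y" and uv': "y = of_int u' + of_int v' * x"
    by (metis latE)
  have cx: "qconj x = of_int u + of_int v * qconj y" using qconj_lin[of y u v] y uv by simp
  have cy: "qconj y = of_int u' + of_int v' * qconj x" using qconj_lin[of x u' v'] x uv' by simp
  have dx: "x - qconj x = of_int v * (y - qconj y)" using uv cx by (simp add: algebra_simps)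
  have dy: "y - qconj y = of_int v' * (x - qconj x)" using uv' cy by (simp add: algebra_simps)
  have pos: "x - qconj x > 0" "y - qconj y > 0" using x y by linarith+
  have "v > 0" using dx pos by (metis of_int_0_less_iff zero_less_mult_pos2)
  moreover have "x - qconj x = of_int (v * v') * (x - qconj x)" using dx dy by simp
  then have "real_of_int (v * v') = 1" using pos by simp
  then have "v * v' = 1" by (simp only: of_int_eq_1_iff)
  ultimately have "v = 1" by (simp add: zmult_eq_1_iff)
  then have "of_int u = qconj x - qconj y" using cx by simp
  then have "-1 < real_of_int u" "real_of_int u < 1" using x y by linarith+
  then have "u = 0" by linarith
  then show ?thesis using uv \<open>v = 1\<close> by simp
qed

text \<open>The first bound makes 1 a minimum of the module, the second makes
  \<open>y - \<lfloor>y\<rfloor>\<close> the next smaller one. For \<open>z\<close> in (0, 1) the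
  coefficients \<open>u\<close> and \<open>v\<close> have opposite signs; as \<open>qconj y\<close>
  is negative, the two terms of the conjugate have equal signs and cannot cancel.\<close>

lemma lat_minimum:
  assumes "reduced_number y" "z \<in> lat y" "0 < z" "z < 1"
  shows "\<bar>qconj z\<bar> > 1" and "\<bar>qconj z\<bar> \<ge> \<bar>qconj (y - of_int \<lfloor>y\<rfloor>)\<bar>"
proof -
  note y = reduced_numberD[OF assms(1)]
  obtain u v where uv: "z = of_int u + of_int v * y" using assms(2) by (rule latE)
  have c: "qconj z = of_int u + of_int v * qconj y" using uv qconj_lin y by simp
  have c': "qconj (y - of_int \<lfloor>y\<rfloor>) = qconj y - of_int \<lfloor>y\<rfloor>" using qconj_shift y by simp
  have fl: "\<lfloor>y\<rfloor> \<ge> 1" using y by (simp add: le_floor_iff)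
  have "v \<noteq> 0"
  proof
    assume "v = 0"
    then have "0 < u" "u < 1" using uv assms by simp_all
    then show False by simp
  qed
  then consider "v \<ge> 1" | "v \<le> -1" by linarith
  then have "\<bar>qconj z\<bar> > 1 \<and> \<bar>qconj z\<bar> \<ge> \<bar>qconj (y - of_int \<lfloor>y\<rfloor>)\<bar>"
  proof cases
    case 1
    have "of_int v * y \<ge> 1 * y" using 1 y by (intro mult_right_mono) auto
    then have "of_int u < 1 - y" using uv assms by linarith
    then have u: "u \<le> - \<lfloor>y\<rfloor>" by linarith
    have "of_int v * qconj y \<le> 1 * qconj y" using 1 y by (intro mult_right_mono_neg) auto
    then have "qconj z \<le> - of_int \<lfloor>y\<rfloor> + qconj y" using u c by linarith
    then show ?thesis using fl y c' by linarith
  next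
    case 2
    have "of_int (- v) * y \<ge> 1 * y" using 2 y by (intro mult_right_mono) auto
    then have "of_int u > y" using uv assms by simp
    then have u: "u \<ge> \<lfloor>y\<rfloor> + 1" by linarith
    have "of_int (- v) * (- qconj y) > 0" using 2 y by (intro mult_pos_pos) auto
    then have "qconj z > of_int \<lfloor>y\<rfloor> + 1" using u c by simp
    then show ?thesis using fl y c' by linarith
  qed
  then show "\<bar>qconj z\<bar> > 1" "\<bar>qconj z\<bar> \<ge> \<bar>qconj (y - of_int \<lfloor>y\<rfloor>)\<bar>" by auto
qed

text \<open>The element \<open>x - \<lfloor>x\<rfloor>\<close> has the conjugate of least absolute value among the elements of \<open>lat x\<close> in \<open>(0, 1)\<close>.
  If it were less than \<open>\<mu>\<close>, dividing it by \<open>\<mu>\<close> would give an element of \<open>lat y\<close> in \<open>(0, 1)\<close> with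
  conjugate at most 1 in absolute value.\<close>

lemma next_minimum:
  assumes x: "reduced_number x" and y: "reduced_number y"
    and eq: "lat x = scal \<mu> (lat y)" and \<mu>: "0 < \<mu>" "\<mu> < 1"
  shows "\<mu> \<le> x - of_int \<lfloor>x\<rfloor>"
proof (rule ccontr)
  define \<phi> where "\<phi> = x - of_int \<lfloor>x\<rfloor>"
  assume "\<not> \<mu> \<le> x - of_int \<lfloor>x\<rfloor>"
  then have less: "\<phi> < \<mu>" by (simp add: \<phi>_def)
  have \<phi>: "\<phi> > 0" unfolding \<phi>_def by (rule reduced_number_frac[OF x])
  have \<mu>x: "\<mu> \<in> lat x" using eq one_in_lat[of y] by force
  have "\<phi> \<in> lat x" using latI[of "- \<lfloor>x\<rfloor>" 1 x] by (simp add: \<phi>_def)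
  then obtain z where z: "z \<in> lat y" "\<phi> = \<mu> * z" using eq by auto
  have "z = \<phi> / \<mu>" using z \<mu> by simp
  then have "0 < z" "z < 1" using \<phi> \<mu> less by simp_all
  then have z1: "\<bar>qconj z\<bar> > 1" using lat_minimum(1)[OF y z(1)] by blast
  have k: "\<mu> \<in> K" "z \<in> K" using \<mu>x z lat_K x y reduced_numberD(1) by blast+
  have "\<bar>qconj \<phi>\<bar> = \<bar>qconj \<mu>\<bar> * \<bar>qconj z\<bar>" using qconj_mult[OF k] z by (simp add: abs_mult)
  moreover have "\<bar>qconj \<mu>\<bar> > 0" using qconj_eq_0_iff[OF k(1)] \<mu> by simp
  ultimately have "\<bar>qconj \<phi>\<bar> > \<bar>qconj \<mu>\<bar>" using z1 by simp
  moreover have "\<bar>qconj \<mu>\<bar> \<ge> \<bar>qconj \<phi>\<bar>"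
    unfolding \<phi>_def by (rule lat_minimum(2)[OF x \<mu>x \<mu>])
  ultimately show False by simp
qed

text \<open>The partial products are unbounded and, by \<open>next_minimum\<close>, cannot jump over
  \<open>\<kappa>\<close>, so one of them equals \<open>\<kappa>\<close>. The complete quotient
  reached there has the same module as \<open>y\<close>, and \<open>reduced_number_eqI\<close>
  identifies the two.\<close>

theorem lat_equivalent_cycle:
  assumes x: "reduced_number x" and y: "reduced_number y"
    and eq: "lat y = scal \<kappa> (lat x)" and \<kappa>: "\<kappa> > 1"
  obtains n where "n > 0" "complete_quotient x n = y" "cf_prod x n = \<kappa>"
proof -
  \<comment> \<open>The factor \<open>?p / \<kappa>\<close>, which is below 1, takes
    \<open>lat y\<close> to \<open>lat ?z\<close>. So it is at most the fractional part of
    \<open>?z\<close>, whose reciprocal is the next factor of the product.\<close>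
  have step: "cf_prod x (Suc n) \<le> \<kappa>" if less: "cf_prod x n < \<kappa>" for n
  proof -
    let ?z = "complete_quotient x n" and ?p = "cf_prod x n"
    have p: "?p > 0" by (rule cf_prod_pos[OF x])
    have z: "reduced_number ?z" by (rule reduced_number_cq[OF x])
    have "lat x = scal (1 / \<kappa>) (lat y)"
      using scal_cancel[of \<kappa> "lat x" 1 "lat y"] eq \<kappa> by simp
    then have "lat ?z = scal (?p * (1 / \<kappa>)) (lat y)"
      by (simp only: lat_cq[OF x] scal_scal)
    then have "lat ?z = scal (?p / \<kappa>) (lat y)" by simp
    then have "?p / \<kappa> \<le> ?z - of_int \<lfloor>?z\<rfloor>"
      by (rule next_minimum[OF z y]) (use p \<kappa> less in simp_all)
    then show ?thesis
      using reduced_number_frac[OF z] \<kappa> by (simp add: cf_prod_Suc field_simps)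
  qed
  have "\<exists>n. cf_prod x n \<ge> \<kappa>"
  proof -
    obtain n where "\<kappa> < 2 ^ n" using real_arch_pow[of 2 \<kappa>] by auto
    then have "\<kappa> \<le> cf_prod x (2 * n)" using cf_prod_unbounded[OF x, of n] by linarith
    then show ?thesis ..
  qed
  define n where "n = (LEAST n. cf_prod x n \<ge> \<kappa>)"
  have ge: "cf_prod x n \<ge> \<kappa>" unfolding n_def by (rule LeastI_ex) fact
  have "n \<noteq> 0" using ge \<kappa> by (intro notI) simp
  then obtain k where k: "n = Suc k" by (cases n) auto
  have "cf_prod x k < \<kappa>" using not_less_Least[of k "\<lambda>n. cf_prod x n \<ge> \<kappa>"] k by (simp add: n_def)
  then have e: "cf_prod x n = \<kappa>" using step[of k] ge k by simp
  then have "complete_quotient x n = y"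
    using lat_cq[OF x, of n] eq by (intro reduced_number_eqI reduced_number_cq x y) simp
  then show ?thesis using that e \<open>n \<noteq> 0\<close> by blast
qed

end

subsection \<open>Products of modules and composition\<close>

definition add_subgroup :: "real set \<Rightarrow> bool" where
  "add_subgroup A \<longleftrightarrow> 0 \<in> A \<and> (\<forall>x\<in>A. \<forall>y\<in>A. x + y \<in> A) \<and> (\<forall>x\<in>A. - x \<in> A)"

lemma add_subgroupD:
  assumes "add_subgroup A"
  shows "0 \<in> A" "x \<in> A \<Longrightarrow> y \<in> A \<Longrightarrow> x + y \<in> A" "x \<in> A \<Longrightarrow> - x \<in> A"
  using assms by (auto simp: add_subgroup_def)

lemma add_subgroup_of_int_mult:
  assumes "add_subgroup A" "x \<in> A" shows "of_int k * x \<in> A"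
proof -
  have nat: "of_nat n * x \<in> A" for n :: nat
    by (induction n) (use assms add_subgroupD[OF assms(1)] in \<open>auto simp: algebra_simps\<close>)
  show ?thesis
  proof (cases "k \<ge> 0")
    case True
    then show ?thesis using nat[of "nat k"] by simp
  next
    case False
    then show ?thesis using add_subgroupD(3)[OF assms(1) nat[of "nat (- k)"]] by simp
  qed
qed

text \<open>The product of two modules. Only sums are generated; negatives are inherited from
  \<open>A\<close> when \<open>A\<close> is a subgroup.\<close>

inductive_set mulspan :: "real set \<Rightarrow> real set \<Rightarrow> real set" for A B where
  mulspan_0: "0 \<in> mulspan A B"
| mulspan_step: "z \<in> mulspan A B \<Longrightarrow> a \<in> A \<Longrightarrow> b \<in> B \<Longrightarrow> z + a * b \<in> mulspan A B"

lemma mulspanI: "a \<in> A \<Longrightarrow> b \<in> B \<Longrightarrow> a * b \<in> mulspan A B"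
  using mulspan_step[OF mulspan_0] by simp

lemma mulspan_add: "z \<in> mulspan A B \<Longrightarrow> w \<in> mulspan A B \<Longrightarrow> w + z \<in> mulspan A B"
  by (induction rule: mulspan.induct) (auto simp flip: add.assoc intro: mulspan_step)

lemma add_subgroup_mulspan:
  assumes "add_subgroup A" shows "add_subgroup (mulspan A B)"
proof -
  have "- z \<in> mulspan A B" if "z \<in> mulspan A B" for z
    using that
  proof (induction rule: mulspan.induct)
    case (mulspan_step z a b)
    then have "- z + (- a) * b \<in> mulspan A B"
      using add_subgroupD(3)[OF assms] by (intro mulspan.mulspan_step) auto
    then show ?case by simp
  qed (simp add: mulspan_0)
  then show ?thesis by (auto simp: add_subgroup_def mulspan_0 intro: mulspan_add)
qed

lemma mulspan_subset:
  assumes "0 \<in> C" "\<And>x y. x \<in> C \<Longrightarrow> y \<in> C \<Longrightarrow> x + y \<in> C"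
    and "\<And>a b. a \<in> A \<Longrightarrow> b \<in> B \<Longrightarrow> a * b \<in> C"
  shows "mulspan A B \<subseteq> C"
proof
  fix z assume "z \<in> mulspan A B"
  then show "z \<in> C" by induction (use assms in auto)
qed

lemma mulspan_commute: "mulspan A B = mulspan B A"
proof -
  have "mulspan A B \<subseteq> mulspan B A" for A B
  proof (rule mulspan_subset)
    fix a b assume "a \<in> A" "b \<in> B"
    then show "a * b \<in> mulspan B A" using mulspanI[of b B a A] by (simp add: mult.commute)
  qed (auto intro: mulspan_0 mulspan_add)
  then show ?thesis by blast
qed

lemma mulspan_assoc_subset: "mulspan (mulspan A B) C \<subseteq> mulspan A (mulspan B C)"
proof (rule mulspan_subset)
  fix z c assume "z \<in> mulspan A B" and c: "c \<in> C"
  then show "z * c \<in> mulspan A (mulspan B C)"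
  proof (induction rule: mulspan.induct)
    case (mulspan_step z a b)
    then have "z * c + a * (b * c) \<in> mulspan A (mulspan B C)"
      using c by (blast intro: mulspan.mulspan_step mulspanI)
    then show ?case by (simp add: algebra_simps)
  qed (simp add: mulspan_0)
qed (auto intro: mulspan_0 mulspan_add)

text \<open>By commutativity, the reverse inclusion is the proved one with the three factors in
  reverse order.\<close>

lemma mulspan_assoc: "mulspan (mulspan A B) C = mulspan A (mulspan B C)"
  using mulspan_assoc_subset[of A B C] mulspan_assoc_subset[of C B A]
  by (metis mulspan_commute subset_antisym)

lemma mulspan_scal_left: "mulspan (scal c A) B = scal c (mulspan A B)"
proof (intro equalityI subsetI)
  show "z \<in> scal c (mulspan A B)" if "z \<in> mulspan (scal c A) B" for z
    using that
  proof (induction rule: mulspan.induct)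
    case (mulspan_step z a b)
    then obtain w a' where *: "w \<in> mulspan A B" "z = c * w" "a' \<in> A" "a = c * a'" by blast
    then have "z + a * b = c * (w + a' * b)" by (simp add: algebra_simps)
    then show ?case using mulspan.mulspan_step[OF *(1,3) mulspan_step(3)] by blast
  qed (force intro: mulspan_0)
next
  fix z assume "z \<in> scal c (mulspan A B)"
  then obtain w where "w \<in> mulspan A B" "z = c * w" by blast
  then show "z \<in> mulspan (scal c A) B"
  proof (induction arbitrary: z rule: mulspan.induct)
    case (mulspan_step w a b)
    have "c * w + (c * a) * b \<in> mulspan (scal c A) B"
      by (intro mulspan.mulspan_step) (use mulspan_step in auto)
    then show ?case using mulspan_step by (simp add: algebra_simps)
  qed (simp add: mulspan_0)
qed

lemma mulspan_scal_right: "mulspan A (scal c B) = scal c (mulspan A B)"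
  by (metis mulspan_commute mulspan_scal_left)

definition lat2 :: "real \<Rightarrow> real \<Rightarrow> real set" where
  "lat2 p q = {of_int u * p + of_int v * q | u v. True}"

lemma lat2I: "z = of_int u * p + of_int v * q \<Longrightarrow> z \<in> lat2 p q"
  by (auto simp: lat2_def)

lemma lat2E:
  assumes "z \<in> lat2 p q" obtains u v where "z = of_int u * p + of_int v * q"
  using assms by (auto simp: lat2_def)

lemma lat2_gens: "p \<in> lat2 p q" "q \<in> lat2 p q"
  by (auto intro: lat2I[of _ 1 _ 0] lat2I[of _ 0 _ 1])

lemma add_subgroup_lin:
  assumes "add_subgroup A" "p \<in> A" "q \<in> A" shows "of_int u * p + of_int v * q \<in> A"
  using assms by (intro add_subgroupD(2) add_subgroup_of_int_mult)

lemma add_subgroup_lat2: "add_subgroup (lat2 p q)"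
proof -
  have "x + y \<in> lat2 p q" if xy: "x \<in> lat2 p q" "y \<in> lat2 p q" for x y
  proof -
    obtain u v where x: "x = of_int u * p + of_int v * q" using xy(1) by (rule lat2E)
    obtain u' v' where y: "y = of_int u' * p + of_int v' * q" using xy(2) by (rule lat2E)
    show ?thesis by (rule lat2I[of _ "u + u'" _ "v + v'"]) (simp add: x y algebra_simps)
  qed
  moreover have "- x \<in> lat2 p q" if x: "x \<in> lat2 p q" for x
  proof -
    obtain u v where x: "x = of_int u * p + of_int v * q" using x by (rule lat2E)
    show ?thesis by (rule lat2I[of _ "- u" _ "- v"]) (simp add: x)
  qed
  ultimately show ?thesis by (auto simp: add_subgroup_def intro: lat2I[of _ 0 _ 0])
qed

lemma lat2_subset: "add_subgroup A \<Longrightarrow> p \<in> A \<Longrightarrow> q \<in> A \<Longrightarrow> lat2 p q \<subseteq> A"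
  by (auto elim!: lat2E intro: add_subgroup_lin)

lemma scal_lat2: "scal c (lat2 p q) = lat2 (c * p) (c * q)"
proof -
  have e: "c * (of_int u * p + of_int v * q) = of_int u * (c * p) + of_int v * (c * q)" for u v
    by (simp add: algebra_simps)
  show ?thesis
  proof (intro equalityI subsetI)
    fix z assume "z \<in> scal c (lat2 p q)"
    then show "z \<in> lat2 (c * p) (c * q)" using e by (auto elim!: lat2E intro: lat2I)
  next
    fix z assume "z \<in> lat2 (c * p) (c * q)"
    then obtain u v where "z = c * (of_int u * p + of_int v * q)" unfolding e by (rule lat2E)
    then show "z \<in> scal c (lat2 p q)" by (blast intro: lat2I)
  qed
qed

lemma lat_eq_lat2: "lat x = lat2 1 x"
  by (simp add: lat_def lat2_def)

lemma mulspan_lat2_subset: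
  assumes A: "add_subgroup A" and "p * r \<in> A" "p * t \<in> A" "q * r \<in> A" "q * t \<in> A"
  shows "mulspan (lat2 p q) (lat2 r t) \<subseteq> A"
proof (rule mulspan_subset)
  fix x y assume xy: "x \<in> lat2 p q" "y \<in> lat2 r t"
  obtain u v where x: "x = of_int u * p + of_int v * q" using xy(1) by (rule lat2E)
  obtain u' v' where y: "y = of_int u' * r + of_int v' * t" using xy(2) by (rule lat2E)
  have "of_int u * (of_int u' * (p * r) + of_int v' * (p * t)) +
        of_int v * (of_int u' * (q * r) + of_int v' * (q * t)) \<in> A"
    by (intro add_subgroup_lin assms)
  then show "x * y \<in> A" by (simp add: x y algebra_simps)
qed (use add_subgroupD[OF A] in auto)

lemma add_subgroup_linI:
  assumes "add_subgroup A" "p \<in> A" "q \<in> A" "z = of_int u * p + of_int v * q" shows "z \<in> A"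
  using add_subgroup_lin[OF assms(1-3)] assms(4) by simp

lemma add_subgroup_gcd:
  assumes "add_subgroup A" "of_int a * r \<in> A" "of_int b * r \<in> A"
  shows "of_int (gcd a b) * r \<in> A"
proof -
  obtain u v where "u * a + v * b = gcd a b" using bezout_int by blast
  then have "real_of_int (gcd a b) = of_int u * of_int a + of_int v * of_int b"
    by (metis of_int_add of_int_mult)
  then show ?thesis
    by (intro add_subgroup_linI[OF assms, of _ u v]) (simp add: algebra_simps)
qed

lemma form_ideal_eq_lat2: "form_ideal N (a, b, c) = lat2 (of_int a) ((of_int b + sqrt (of_int N)) / 2)"
  by (simp add: lat2_def)

text \<open>Passing to the absolute value of \<open>a\<close> only changes the sign of a generator;
  dividing by it turns the other generator into the term.\<close>

lemma form_ideal_eq_lat: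
  assumes "a \<noteq> 0"
  shows "form_ideal N (a, b, c) = scal (of_int \<bar>a\<bar>) (lat (form_term N (a, b, c)))"
proof -
  have "lat2 (of_int a) q = lat2 (of_int \<bar>a\<bar>) q" for q
    by (intro equalityI lat2_subset add_subgroup_lat2 lat2_gens)
      (auto intro: lat2I[of _ "sgn a" _ 0] simp: abs_sgn[of a] simp flip: of_int_mult)
  moreover have "of_int \<bar>a\<bar> * form_term N (a, b, c) = (of_int b + sqrt (of_int N)) / 2"
    using assms by (simp add: field_simps)
  ultimately show ?thesis
    by (simp only: form_ideal_eq_lat2 lat_eq_lat2 scal_lat2 mult_1_right)
qed

section \<open>The quadratic order and the composition of ideals\<close>

locale real_quadratic_order = real_quadratic +
  assumes N_mod: "[N = 1] (mod 4)"
begin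

text \<open>The quadratic order of discriminant \<open>N\<close>, which may be a non-maximal
  order.\<close>

definition ord :: "real set" where
  "ord = lat2 1 ((1 + s) / 2)"

lemma N_ge_5: "N \<ge> 5"
proof (rule ccontr)
  assume "\<not> N \<ge> 5"
  then have "N \<in> {1,2,3,4}" using N_pos by auto
  then have "N = 1" using N_mod by (auto simp: cong_def)
  then show False using N_nonsquare by simp
qed

lemma s_gt_2: "s > 2"
proof -
  have "sqrt (of_int N) > sqrt 4" using N_ge_5 by (simp only: real_sqrt_less_iff)
  then show ?thesis by simp
qed

lemma odd_middle:
  assumes "disc (a, b, c) = N" obtains k where "b = 2 * k + 1"
proof -
  have "b\<^sup>2 mod 4 = 1" using assms N_mod by (auto simp: cong_def mod_diff_eq[symmetric] mod_mult_left_eq[symmetric])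
  then have "odd b" by (auto elim!: evenE)
  then show ?thesis using that by (auto elim: oddE)
qed

text \<open>A generator may be shifted by an integer. Thus the order can be written with the second
  generator of the ideal of any form of discriminant \<open>N\<close>, whose middle coefficient is
  odd.\<close>

lemma ord_eq: "ord = lat2 1 ((of_int (2 * k + 1) + s) / 2)"
  unfolding ord_def
  by (intro equalityI lat2_subset add_subgroup_lat2 lat2_gens)
    (auto intro: lat2I[of _ "- k" _ 1] lat2I[of _ k _ 1] simp: field_simps)

text \<open>The generator \<open>(b + s) / 2\<close> is a root of the monic polynomial with
  coefficients \<open>- b\<close> and \<open>a * c\<close>.\<close>

lemma root_eq:
  assumes "disc (a, b, c) = N"
  shows "(of_int b + s) / 2 * ((of_int b + s) / 2) = of_int b * ((of_int b + s) / 2) - of_int a * of_int c"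
proof -
  have "s * s = of_int b * of_int b - 4 * of_int a * of_int c"
    using s_sq assms by (auto simp: power2_eq_square)
  then show ?thesis by (simp add: field_simps)
qed

text \<open>The ideal is closed under multiplication by \<open>w\<close>, by the quadratic equation
  of \<open>w\<close>; the reverse inclusion holds because the order contains 1.\<close>

lemma mulspan_ideal_ord:
  assumes "disc (a, b, c) = N"
  shows "mulspan (form_ideal N (a, b, c)) ord = form_ideal N (a, b, c)"
proof
  obtain k where k: "b = 2 * k + 1" using odd_middle[OF assms] .
  define w where "w = (of_int b + s) / 2"
  have o: "ord = lat2 1 w" unfolding w_def k by (rule ord_eq)
  have I: "form_ideal N (a, b, c) = lat2 (of_int a) w" unfolding form_ideal_eq_lat2 w_def ..
  have w: "w * w = of_int b * w - of_int a * of_int c" unfolding w_def by (rule root_eq[OF assms])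
  show "mulspan (form_ideal N (a, b, c)) ord \<subseteq> form_ideal N (a, b, c)"
    unfolding I o
    by (intro mulspan_lat2_subset add_subgroup_lat2)
      (auto intro: lat2I[of _ 1 _ 0] lat2I[of _ 0 _ a] lat2I[of _ 0 _ 1] lat2I[of _ "- c" _ b] simp: w)
  show "form_ideal N (a, b, c) \<subseteq> mulspan (form_ideal N (a, b, c)) ord"
    using mulspanI[of _ _ 1 ord] lat2_gens(1)[of 1] by (force simp: ord_def)
qed

text \<open>Since \<open>(- b + \<surd>N) / 2\<close> is the negative of the conjugate of \<open>(b + \<surd>N) / 2\<close>, the form
  \<open>(a, - b, c)\<close> corresponds to the conjugate ideal.\<close>

lemma mulspan_ideal_conj:
  assumes "disc (a, b, c) = N" "primitive_form (a, b, c)"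
  shows "mulspan (form_ideal N (a, b, c)) (form_ideal N (a, - b, c)) = scal (of_int a) ord"
proof
  obtain k where k: "b = 2 * k + 1" using odd_middle[OF assms(1)] .
  define w where "w = (of_int b + s) / 2"
  define w' where "w' = (of_int (- b) + s) / 2"
  have o: "scal (of_int a) ord = lat2 (of_int a) (of_int a * w)"
    unfolding w_def k ord_eq[of k] scal_lat2 by simp
  have I: "form_ideal N (a, b, c) = lat2 (of_int a) w" unfolding form_ideal_eq_lat2 w_def ..
  have I': "form_ideal N (a, - b, c) = lat2 (of_int a) w'" unfolding form_ideal_eq_lat2 w'_def ..
  have w': "w' = w - of_int b" by (simp add: w_def w'_def field_simps)
  have w: "w * w = of_int b * w - of_int a * of_int c" unfolding w_def by (rule root_eq[OF assms(1)])
  have ww': "w * w' = - of_int a * of_int c" unfolding w' by (simp add: algebra_simps w)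
  have "mulspan (lat2 (of_int a) w) (lat2 (of_int a) w') \<subseteq> lat2 (of_int a) (of_int a * w)"
  proof (intro mulspan_lat2_subset add_subgroup_lat2)
    show "of_int a * of_int a \<in> lat2 (of_int a) (of_int a * w)"
      by (rule lat2I[of _ a _ 0]) simp
    show "of_int a * w' \<in> lat2 (of_int a) (of_int a * w)"
      by (rule lat2I[of _ "- b" _ 1]) (simp add: w' algebra_simps)
    show "w * of_int a \<in> lat2 (of_int a) (of_int a * w)"
      by (rule lat2I[of _ 0 _ 1]) simp
    show "w * w' \<in> lat2 (of_int a) (of_int a * w)"
      by (rule lat2I[of _ "- c" _ 0]) (simp add: ww')
  qed
  then show "mulspan (form_ideal N (a, b, c)) (form_ideal N (a, - b, c)) \<subseteq> scal (of_int a) ord"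
    unfolding I I' o .
  let ?M = "mulspan (lat2 (of_int a) w) (lat2 (of_int a) w')"
  have M: "add_subgroup ?M" by (intro add_subgroup_mulspan add_subgroup_lat2)
  \<comment> \<open>The product contains the multiples of \<open>of_int a\<close> by
    \<open>a\<close>, by \<open>b\<close> (from the difference of \<open>a * w\<close> and
    \<open>a * w'\<close>) and by \<open>c\<close> (from \<open>w * w'\<close>). By primitivity
    their gcd is 1, so it contains \<open>of_int a\<close> itself.\<close>
  have m: "of_int a * of_int a \<in> ?M" "of_int a * w' \<in> ?M" "w * of_int a \<in> ?M" "w * w' \<in> ?M"
    by (intro mulspanI lat2_gens)+
  have b: "of_int b * of_int a \<in> ?M"
    by (rule add_subgroup_linI[OF M m(2,3), of _ "- 1" 1]) (simp add: w' algebra_simps)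
  have c: "of_int c * of_int a \<in> ?M"
    by (rule add_subgroup_linI[OF M m(4,4), of _ "- 1" 0]) (simp add: ww')
  have "of_int (gcd a (gcd b c)) * of_int a \<in> ?M"
    by (intro add_subgroup_gcd M b c m)
  then have "of_int a \<in> ?M" using assms(2) by simp
  then have "lat2 (of_int a) (of_int a * w) \<subseteq> ?M"
    using m(3) by (intro lat2_subset M) (simp_all add: mult.commute)
  then show "scal (of_int a) ord \<subseteq> mulspan (form_ideal N (a, b, c)) (form_ideal N (a, - b, c))"
    unfolding I I' o .
qed

text \<open>Dividing \<open>a1\<close>, \<open>a2\<close>, \<open>t\<close> by \<open>m\<close>
  gives coprime \<alpha>, \<beta>, \<sigma>, and the congruences for \<open>B\<close> provide
  integers \<open>i\<close>, \<open>j\<close>, \<open>k\<close>. With these, all four products of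
  generators become explicit combinations of \<open>r\<close> and \<open>m * W\<close>, which gives
  one inclusion. For the other, \<open>r\<close> and then \<open>m * W\<close> are recovered by
  coprimality.\<close>

lemma composition_ideal:
  assumes d1: "disc (a1, b1, c1) = N" and d2: "disc (a2, b2, c2) = N"
    and prim: "primitive_form (a1, b1, c1)" and nz: "a1 \<noteq> 0" "a2 \<noteq> 0"
    and comp: "is_composition N (a1, b1, c1) (a2, b2, c2) (A, B, C)"
  defines "m \<equiv> comp_factor (a1, b1, c1) (a2, b2, c2)"
  shows "mulspan (form_ideal N (a1, b1, c1)) (form_ideal N (a2, b2, c2)) =
           scal (of_int m) (form_ideal N (A, B, C))"
    and "A * m\<^sup>2 = a1 * a2"
proof -
  obtain k1 where k1: "b1 = 2 * k1 + 1" using odd_middle[OF d1] .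
  obtain k2 where k2: "b2 = 2 * k2 + 1" using odd_middle[OF d2] .
  define t where "t = k1 + k2 + 1"
  have t: "b1 + b2 = 2 * t" "(b1 + b2) div 2 = t" by (simp_all add: k1 k2 t_def)
  have m: "m = gcd a1 (gcd a2 t)" by (simp add: m_def t)
  have m_pos: "m > 0" unfolding m using nz by simp
  have "m dvd a1" "m dvd a2" "m dvd t" unfolding m by (meson dvd_trans gcd_dvd1 gcd_dvd2)+
  then obtain \<alpha> \<beta> \<sigma> where abs: "a1 = m * \<alpha>" "a2 = m * \<beta>" "t = m * \<sigma>"
    by (elim dvdE)
  have "m * gcd \<alpha> (gcd \<beta> \<sigma>) = m"
    using m m_pos by (simp add: abs gcd_mult_left)
  then have cop: "gcd \<alpha> (gcd \<beta> \<sigma>) = 1" using m_pos by simp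
  have nz': "\<alpha> \<noteq> 0" "\<beta> \<noteq> 0" "m \<noteq> 0" using nz abs by auto
  have Neq: "N = b1 * b1 - 4 * a1 * c1" using d1 by (simp add: power2_eq_square)
  have half: "(b1 * b2 + N) div 2 = b1 * t - 2 * a1 * c1"
  proof -
    have "b1 * b2 + N = b1 * (b1 + b2) - 4 * a1 * c1" by (simp add: Neq algebra_simps)
    also have "\<dots> = 2 * (b1 * t - 2 * a1 * c1)" by (simp add: t(1) algebra_simps)
    finally show ?thesis by simp
  qed
  have mid: "comp_middle N (a1, b1, c1) (a2, b2, c2) B" and A: "A = a1 * a2 div m\<^sup>2"
    using comp by (auto simp: m_def Let_def)
  have A': "A = \<alpha> * \<beta>" using nz' by (simp add: A abs power2_eq_square)
  then show "A * m\<^sup>2 = a1 * a2" by (simp add: abs power2_eq_square)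
  have mid': "2 * a1 * a2 dvd a2 * m * B - m * b1 * a2" "2 * a1 * a2 dvd a1 * m * B - m * b2 * a1"
    "2 * a1 * a2 dvd t * m * B - m * (b1 * t - 2 * a1 * c1)"
    using mid unfolding comp_middle.simps Let_def m_def[symmetric] t(2) half cong_iff_dvd_diff by auto
  have "m * m * \<beta> * (2 * \<alpha>) dvd m * m * \<beta> * (B - b1)"
    using mid'(1) by (simp add: abs algebra_simps)
  then have "2 * \<alpha> dvd B - b1" using nz' by (subst (asm) dvd_mult_cancel_left) simp
  then obtain i where i: "B = b1 + 2 * \<alpha> * i" by (metis dvdE diff_eq_eq add.commute)
  have "m * m * \<alpha> * (2 * \<beta>) dvd m * m * \<alpha> * (B - b2)"
    using mid'(2) by (simp add: abs algebra_simps)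
  then have "2 * \<beta> dvd B - b2" using nz' by (subst (asm) dvd_mult_cancel_left) simp
  then obtain j where j: "B = b2 + 2 * \<beta> * j" by (metis dvdE diff_eq_eq add.commute)
  \<comment> \<open>Once \<open>B - b1 = 2 * \<alpha> * i\<close> is inserted, the third congruence
    can be divided by \<open>m * m * 2 * \<alpha>\<close>, which leaves a divisibility by
    \<beta>.\<close>
  have "t * m * B - m * (b1 * t - 2 * a1 * c1) = m * m * 2 * \<alpha> * (\<sigma> * i + c1)"
    by (simp add: abs i algebra_simps)
  then have "m * m * 2 * \<alpha> * \<beta> dvd m * m * 2 * \<alpha> * (\<sigma> * i + c1)"
    using mid'(3) by (simp add: abs algebra_simps)
  then have "\<beta> dvd \<sigma> * i + c1" using nz' by (subst (asm) dvd_mult_cancel_left) simp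
  then obtain k where k: "\<sigma> * i + c1 = \<beta> * k" by (elim dvdE)
  have W1: "(of_int b1 + s) / 2 = (of_int B + s) / 2 - of_int (\<alpha> * i)" by (simp add: i field_simps)
  have W2: "(of_int b2 + s) / 2 = (of_int B + s) / 2 - of_int (\<beta> * j)" by (simp add: j field_simps)
  define W w1 w2 where "W = (of_int B + s) / 2" and "w1 = (of_int b1 + s) / 2" and "w2 = (of_int b2 + s) / 2"
  \<comment> \<open>As \<open>A = \<alpha> * \<beta>\<close>, the numbers \<open>r = m * A\<close>
    and \<open>m * W\<close> generate the right-hand side.\<close>
  define r where "r = real_of_int m * of_int \<alpha> * of_int \<beta>"
  have w1: "w1 = W - of_int \<alpha> * of_int i" and w2: "w2 = W - of_int \<beta> * of_int j"
    using W1 W2 by (simp_all add: W_def w1_def w2_def)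
  have p1: "of_int a1 * of_int a2 = of_int m * r" by (simp add: r_def abs)
  have p2: "of_int a1 * w2 = of_int \<alpha> * (of_int m * W) - of_int j * r"
    by (simp add: r_def abs w2 algebra_simps)
  have p3: "w1 * of_int a2 = of_int \<beta> * (of_int m * W) - of_int i * r"
    by (simp add: r_def abs w1 algebra_simps)
  have p4: "w1 * w2 = of_int \<sigma> * (of_int m * W) - of_int k * r"
  proof -
    have sq: "w1 * w1 = of_int b1 * w1 - of_int a1 * of_int c1"
      unfolding w1_def by (rule root_eq[OF d1])
    have sum: "w2 = w1 + of_int t - of_int b1"
    proof -
      have "real_of_int (b1 + b2) = of_int (2 * t)" by (simp only: t(1))
      then show ?thesis by (simp add: w1_def w2_def field_simps)
    qed
    have "w1 * w2 = w1 * w1 + (of_int t - of_int b1) * w1" by (simp add: sum algebra_simps)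
    also have "\<dots> = of_int t * w1 - of_int a1 * of_int c1" by (simp add: sq algebra_simps)
    also have "\<dots> = of_int \<sigma> * (of_int m * W) - of_int m * of_int \<alpha> * of_int (\<sigma> * i + c1)"
      by (simp add: w1 abs algebra_simps)
    also have "\<dots> = of_int \<sigma> * (of_int m * W) - of_int k * r" unfolding k r_def by simp
    finally show ?thesis .
  qed
  have I1: "form_ideal N (a1, b1, c1) = lat2 (of_int a1) w1"
    and I2: "form_ideal N (a2, b2, c2) = lat2 (of_int a2) w2"
    unfolding form_ideal_eq_lat2 w1_def w2_def by simp_all
  have IC: "scal (of_int m) (form_ideal N (A, B, C)) = lat2 r (of_int m * W)"
    unfolding form_ideal_eq_lat2 scal_lat2 W_def[symmetric] A' r_def by (simp add: mult.assoc)
  let ?M = "mulspan (lat2 (of_int a1) w1) (lat2 (of_int a2) w2)"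
  have M: "add_subgroup ?M" by (intro add_subgroup_mulspan add_subgroup_lat2)
  have g: "of_int a1 * of_int a2 \<in> ?M" "of_int a1 * w2 \<in> ?M" "w1 * of_int a2 \<in> ?M" "w1 * w2 \<in> ?M"
    by (intro mulspanI lat2_gens)+
  have "?M \<subseteq> lat2 r (of_int m * W)"
  proof (intro mulspan_lat2_subset add_subgroup_lat2)
    show "of_int a1 * of_int a2 \<in> lat2 r (of_int m * W)"
      by (rule lat2I[of _ m _ 0]) (simp add: p1)
    show "of_int a1 * w2 \<in> lat2 r (of_int m * W)"
      by (rule lat2I[of _ "- j" _ \<alpha>]) (simp add: p2)
    show "w1 * of_int a2 \<in> lat2 r (of_int m * W)"
      by (rule lat2I[of _ "- i" _ \<beta>]) (simp add: p3)
    show "w1 * w2 \<in> lat2 r (of_int m * W)"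
      by (rule lat2I[of _ "- k" _ \<sigma>]) (simp add: p4)
  qed
  moreover have "lat2 r (of_int m * W) \<subseteq> ?M"
  proof -
    \<comment> \<open>The syzygies of \<open>a1, a2, t\<close> make the \<open>\<surd>N\<close>-parts cancel and leave the multiples \<open>m r\<close>, \<open>h r\<close>, \<open>c1 r\<close>
      of \<open>r\<close>, whose coefficients are coprime because a common divisor divides \<open>a1\<close>, \<open>b1\<close>, \<open>c1\<close>.\<close>
    define h where "h = t - b2"
    have h: "h = \<beta> * j - \<alpha> * i" "b1 = t + h" using i j t(1) by (simp_all add: h_def)
    have "of_int h * r \<in> ?M"
    proof (rule add_subgroup_linI[OF M g(3,2), of _ \<alpha> "- \<beta>"])
      show "of_int h * r = of_int \<alpha> * (w1 * of_int a2) + of_int (- \<beta>) * (of_int a1 * w2)"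
        unfolding p2 p3 h(1) by (simp add: algebra_simps)
    qed
    moreover have "of_int c1 * r \<in> ?M"
    proof (rule add_subgroup_linI[OF M g(3,4), of _ \<sigma> "- \<beta>"])
      have c1: "c1 = \<beta> * k - \<sigma> * i" using k by simp
      show "of_int c1 * r = of_int \<sigma> * (w1 * of_int a2) + of_int (- \<beta>) * (w1 * w2)"
        unfolding p3 p4 c1 by (simp add: algebra_simps)
    qed
    moreover have "of_int m * r \<in> ?M" using g(1) p1 by simp
    ultimately have "of_int (gcd m (gcd h c1)) * r \<in> ?M" by (intro add_subgroup_gcd M)
    moreover have "gcd m (gcd h c1) = 1"
    proof -
      let ?g = "gcd m (gcd h c1)"
      have d: "?g dvd m" "?g dvd h" "?g dvd c1" by (meson dvd_trans gcd_dvd1 gcd_dvd2)+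
      have "?g dvd a1" using d(1) by (simp only: abs dvd_mult2)
      moreover have "?g dvd b1" using d(1,2) unfolding h(2) abs(3) by (intro dvd_add dvd_mult2)
      ultimately have "?g dvd gcd a1 (gcd b1 c1)" using d(3) by (intro gcd_greatest)
      then have "?g dvd 1" using prim by (simp only: primitive_form.simps)
      then show ?thesis by (simp only: is_unit_gcd_iff)
    qed
    ultimately have r: "r \<in> ?M" by simp
    \<comment> \<open>With \<open>r\<close> available, the equations \<open>p2\<close>,
      \<open>p3\<close>, \<open>p4\<close> leave multiples of \<open>m * W\<close> by the coprime
      numbers \<alpha>, \<beta>, \<sigma>.\<close>
    have "of_int \<alpha> * (of_int m * W) \<in> ?M"
      by (rule add_subgroup_linI[OF M g(2) r, of _ 1 j]) (simp add: p2)
    moreover have "of_int \<beta> * (of_int m * W) \<in> ?M"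
      by (rule add_subgroup_linI[OF M g(3) r, of _ 1 i]) (simp add: p3)
    moreover have "of_int \<sigma> * (of_int m * W) \<in> ?M"
      by (rule add_subgroup_linI[OF M g(4) r, of _ 1 k]) (simp add: p4)
    ultimately have "of_int (gcd \<alpha> (gcd \<beta> \<sigma>)) * (of_int m * W) \<in> ?M" by (intro add_subgroup_gcd M)
    then have "of_int m * W \<in> ?M" using cop by simp
    then show ?thesis by (intro lat2_subset M r)
  qed
  ultimately show "mulspan (form_ideal N (a1, b1, c1)) (form_ideal N (a2, b2, c2)) =
           scal (of_int m) (form_ideal N (A, B, C))"
    unfolding I1 I2 IC by blast
qed

end

subsection \<open>Distances as scaling factors\<close>

lemma reduced_lead_nonzero: "reduced N (a, b, c) \<Longrightarrow> a \<noteq> 0"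
  by auto

lemma reduces_to_reduced: "reduces_to N f h \<Longrightarrow> reduced N h"
  by (induction rule: reduces_to.induct) auto

lemma common_divisor_form_eval:
  fixes d a b c :: int
  assumes "d dvd a" "d dvd b" "d dvd c" shows "d dvd form_eval (a, b, c) x y"
  using assms by simp

text \<open>A common divisor of the coefficients of \<open>g\<close> divides all values of
  \<open>g\<close>. By the inverse substitution these include the values of \<open>f\<close> at (1,
  0), (0, 1) and (1, 1), from which the coefficients of \<open>f\<close> are obtained.\<close>

lemma primitive_form_properly_equivalent:
  assumes "properly_equivalent f g" "primitive_form f" shows "primitive_form g"
proof -
  obtain a b c a' b' c' where f: "f = (a, b, c)" and g: "g = (a', b', c')"
    by (metis prod_cases3)
  obtain p q u v where det: "p * v - q * u = 1"
    and sub: "\<And>x y. form_eval g x y = form_eval f (p * x + q * y) (u * x + v * y)"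
    using assms(1) by (auto simp: properly_equivalent_def is_subst_def)
  define d where "d = gcd a' (gcd b' c')"
  have ev: "d dvd form_eval f x y" for x y
  proof -
    have "p * (v * x - q * y) + q * (p * y - u * x) = (p * v - q * u) * x"
      "u * (v * x - q * y) + v * (p * y - u * x) = (p * v - q * u) * y"
      by (simp_all add: algebra_simps)
    then have "form_eval f x y = form_eval g (v * x - q * y) (p * y - u * x)"
      by (simp add: sub det)
    moreover have "d dvd a'" "d dvd b'" "d dvd c'"
      unfolding d_def by (meson dvd_trans gcd_dvd1 gcd_dvd2)+
    ultimately show ?thesis unfolding g by (metis common_divisor_form_eval)
  qed
  have "d dvd a" "d dvd c" using ev[of 1 0] ev[of 0 1] by (simp_all add: f)
  moreover have "d dvd a + b + c" using ev[of 1 1] by (simp add: f)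
  ultimately have "d dvd gcd a (gcd b c)"
    by (intro gcd_greatest) (simp_all add: dvd_add_right_iff dvd_add_left_iff)
  then have "d dvd 1" using assms(2) by (simp only: f primitive_form.simps)
  then show ?thesis by (simp only: g primitive_form.simps d_def is_unit_gcd_iff)
qed

section \<open>Reduced forms, their terms and their ideals\<close>

context real_quadratic
begin

text \<open>With \<open>A\<close> the absolute value of \<open>a\<close>, the three bounds on the
  term and its conjugate read \<open>2 * A < s + b\<close>, \<open>s - b < 2 * A\<close> and
  \<open>b < s\<close>.\<close>

lemma reduced_number_form_term:
  assumes "reduced N F" shows "reduced_number (form_term N F)"
proof -
  obtain a b c where F: "F = (a, b, c)" by (metis prod_cases3)
  have a: "a \<noteq> 0" using assms reduced_lead_nonzero unfolding F by blast
  define A where "A = real_of_int \<bar>a\<bar>"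
  have A: "A > 0" using a by (simp add: A_def)
  have red: "\<bar>s - 2 * A\<bar> < of_int b" "of_int b < s" using assms by (auto simp: F A_def)
  have x: "form_term N F = of_int b / (2 * A) + (1 / (2 * A)) * s"
    by (simp add: F A_def add_divide_distrib)
  have rat: "of_int b / (2 * A) \<in> \<rat>" "1 / (2 * A) \<in> \<rat>" by (simp_all add: A_def)
  have "qconj (form_term N F) = of_int b / (2 * A) - (1 / (2 * A)) * s"
    unfolding x by (rule qconj_rep[OF rat])
  then have c: "qconj (form_term N F) = (of_int b - s) / (2 * A)"
    by (simp add: diff_divide_distrib)
  have x': "form_term N F = (s + of_int b) / (2 * A)" by (simp add: F A_def)
  have "form_term N F \<in> K" unfolding x by (rule KI[OF rat])
  moreover have "form_term N F > 1" "-1 < qconj (form_term N F)" "qconj (form_term N F) < 0"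
    unfolding c unfolding x' using A red by (simp_all add: field_simps)
  ultimately show ?thesis by (simp add: reduced_number_def)
qed

text \<open>By irrationality of \<open>s\<close>, an integer in the ideal has \<open>v = 0\<close>,
  so it is a multiple of \<open>a\<close>.\<close>

lemma least_pos_int_form_ideal:
  assumes "a \<noteq> 0" shows "least_pos_int (form_ideal N (a, b, c)) = nat \<bar>a\<bar>"
  unfolding least_pos_int_def
proof (rule Least_equality)
  have "real (nat \<bar>a\<bar>) = of_int \<bar>a\<bar>" by simp
  also have "\<dots> = of_int (sgn a) * of_int a"
    by (simp only: abs_sgn[of a] mult.commute of_int_mult)
  finally have "real (nat \<bar>a\<bar>) = of_int (sgn a) * of_int a" .
  then show "0 < nat \<bar>a\<bar> \<and> real (nat \<bar>a\<bar>) \<in> form_ideal N (a, b, c)"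
    using assms unfolding form_ideal_eq_lat2 by (auto intro: lat2I[of _ "sgn a" _ 0])
next
  fix n assume n: "0 < n \<and> real n \<in> form_ideal N (a, b, c)"
  then obtain u v where uv: "real n = of_int u * of_int a + of_int v * ((of_int b + s) / 2)"
    by auto
  have "of_int u * of_int a + of_int v * of_int b / 2 = real n \<and> real_of_int v / 2 = 0"
    by (rule rep_unique) (use uv in \<open>simp_all add: field_simps\<close>)
  then have "real n = of_int (u * a)" by auto
  then have "int n = u * a" by (metis of_int_eq_iff of_int_of_nat_eq)
  then have "a dvd int n" "int n > 0" using n by simp_all
  then have "\<bar>a\<bar> \<le> int n" by (simp add: zdvd_imp_le)
  then show "nat \<bar>a\<bar> \<le> n" by simp
qed

text \<open>The least positive integers cancel against the factors from
  \<open>form_ideal_eq_lat\<close>, so that only \<open>1 / \<theta> = exp d\<close>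
  remains.\<close>

lemma reduction_distance_lat:
  assumes "is_reduction_distance (form_ideal N (a, b, c)) (form_ideal N (a', b', c')) d"
    and nz: "a \<noteq> 0" "a' \<noteq> 0"
  shows "lat (form_term N (a', b', c')) = scal (exp d) (lat (form_term N (a, b, c)))"
proof -
  let ?x = "form_term N (a, b, c)" and ?y = "form_term N (a', b', c')"
  obtain \<theta> where \<theta>: "\<theta> > 0" "d = - ln \<theta>"
    "scal (of_int \<bar>a\<bar> * \<theta>) (form_ideal N (a', b', c')) = scal (of_int \<bar>a'\<bar>) (form_ideal N (a, b, c))"
    using assms(1) unfolding is_reduction_distance_def
      least_pos_int_form_ideal[OF nz(1)] least_pos_int_form_ideal[OF nz(2)] by auto
  have "scal (of_int \<bar>a\<bar> * \<theta> * of_int \<bar>a'\<bar>) (lat ?y) = scal (of_int \<bar>a'\<bar> * of_int \<bar>a\<bar>) (lat ?x)"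
    using \<theta>(3) by (simp only: form_ideal_eq_lat nz scal_scal not_False_eq_True)
  then have "lat ?y = scal (of_int \<bar>a'\<bar> * of_int \<bar>a\<bar> / (of_int \<bar>a\<bar> * \<theta> * of_int \<bar>a'\<bar>)) (lat ?x)"
    by (rule scal_cancel[rotated]) (use nz \<theta> in simp)
  moreover have "of_int \<bar>a'\<bar> * of_int \<bar>a\<bar> / (of_int \<bar>a\<bar> * \<theta> * of_int \<bar>a'\<bar>) = exp d"
    using \<theta> nz by (simp add: exp_minus field_simps)
  ultimately show ?thesis by simp
qed

lemma distance_lat:
  assumes "is_distance N F G d" "reduced N F"
  shows "lat (form_term N G) = scal (exp d) (lat (form_term N F))"
proof -
  obtain x m n where *: "m < n" "complete_quotient x m = form_term N F"
    "complete_quotient x n = form_term N G" "d = cf_distance x m n"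
    using assms(1) by (auto simp: is_distance_def)
  have red: "reduced_number (form_term N F)" by (rule reduced_number_form_term[OF assms(2)])
  have "form_term N G = complete_quotient (form_term N F) (n - m)"
    using complete_quotient_add[of x m "n - m"] * by simp
  moreover have "exp d = cf_prod (form_term N F) (n - m)"
    using * cf_distance_eq[of m n x] cf_prod_pos[OF red] by simp
  ultimately show ?thesis by (simp only: lat_cq[OF red])
qed

lemma is_distance_cf_prod:
  assumes "n > 0" "complete_quotient (form_term N F) n = form_term N G"
  shows "is_distance N F G (ln (cf_prod (form_term N F) n))"
  unfolding is_distance_def
  by (rule exI[of _ "form_term N F"], rule exI[of _ 0], rule exI[of _ n])
    (use assms cf_distance_eq[of 0 n "form_term N F"] in simp)

text \<open>The divisibility says that \<open>x\<close> is the term of an integral form of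
  discriminant \<open>N\<close>. It keeps numerator and denominator integral along the expansion, so
  that only finitely many complete quotients can occur.\<close>

definition integral_quotient :: "real \<Rightarrow> bool" where
  "integral_quotient x \<longleftrightarrow>
     reduced_number x \<and> (\<exists>a b. a > 0 \<and> 4 * a dvd N - b\<^sup>2 \<and> x = (of_int b + s) / (2 * of_int a))"

lemma qconj_quotient: "qconj ((of_int b + s) / (2 * of_int a)) = (of_int b - s) / (2 * of_int a)"
  using qconj_rep[of "of_int b / (2 * of_int a)" "1 / (2 * of_int a)"]
  by (simp add: add_divide_distrib diff_divide_distrib)

lemma integral_quotient_bounds:
  assumes "integral_quotient x"
  obtains a b where "a \<in> {0..N}" "b \<in> {0..N}" "x = (of_int b + s) / (2 * of_int a)"
proof -
  obtain a b where ab: "a > 0" "x = (of_int b + s) / (2 * of_int a)" and x: "reduced_number x"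
    using assms by (auto simp: integral_quotient_def)
  note r = reduced_numberD[OF x]
  have "(of_int b - s) / (2 * of_int a) < 0" "-1 < (of_int b - s) / (2 * of_int a)"
    "(of_int b + s) / (2 * of_int a) > 1"
    using r qconj_quotient[of b a] ab by simp_all
  then have "of_int b < s" "s - of_int b < 2 * of_int a" "2 * of_int a < of_int b + s"
    using ab(1) by (simp_all add: field_simps)
  then have "of_int b > (0::real)" "of_int a < s" "of_int b < s" by linarith+
  moreover have "s \<le> of_int N"
  proof -
    have "s \<ge> 1" using N_pos by simp
    then have "s * 1 \<le> s * s" by (intro mult_left_mono) simp_all
    then show ?thesis using s_sq by simp
  qed
  ultimately show ?thesis using that[of a b] ab by simp
qed

lemma finite_integral_quotient: "finite {x. integral_quotient x}"
proof (rule finite_subset)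
  show "{x. integral_quotient x} \<subseteq>
    (\<lambda>(a, b). (of_int b + s) / (2 * of_int a)) ` ({0..N} \<times> {0..N})"
    by (force elim!: integral_quotient_bounds)
qed simp

text \<open>The classical recurrence: \<open>b' = 2 * a * n - b\<close> and
  \<open>4 * a * a' = N - b'\<^sup>2\<close>. The new denominator is positive because the conjugate
  of the new quotient is negative.\<close>

lemma integral_quotient_step:
  assumes "integral_quotient x" shows "integral_quotient (1 / (x - of_int \<lfloor>x\<rfloor>))"
proof -
  obtain a b where ab: "a > 0" "4 * a dvd N - b\<^sup>2" "x = (of_int b + s) / (2 * of_int a)"
    and x: "reduced_number x"
    using assms by (auto simp: integral_quotient_def)
  define n where "n = \<lfloor>x\<rfloor>"
  define b' where "b' = 2 * a * n - b"
  obtain c where c: "N - b\<^sup>2 = 4 * a * c" using ab(2) by blast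
  define a' where "a' = c + n * b - a * n\<^sup>2"
  have N': "N - b'\<^sup>2 = 4 * a * a'"
    using c by (simp add: b'_def a'_def power2_eq_square algebra_simps)
  have xn: "x - of_int n = (s - of_int b') / (2 * of_int a)"
    using ab by (simp add: b'_def field_simps)
  have f: "x - of_int n > 0" unfolding n_def by (rule reduced_number_frac[OF x])
  have y: "reduced_number (1 / (x - of_int n))" unfolding n_def by (rule reduced_number_step[OF x])
  have sb: "s - of_int b' > 0" using f ab(1) unfolding xn by (simp add: zero_less_divide_iff)
  have prod: "(s - of_int b') * (s + of_int b') = 4 * of_int a * of_int a'"
  proof -
    have "(s - of_int b') * (s + of_int b') = of_int (N - b'\<^sup>2)"
      using s_sq by (simp add: algebra_simps power2_eq_square)
    then show ?thesis unfolding N' by simp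
  qed
  have "a' \<noteq> 0"
  proof
    assume "a' = 0"
    then have "s = - of_int b'" using prod sb by simp
    then show False using s_irrational by simp
  qed
  have eq: "1 / (x - of_int n) = (of_int b' + s) / (2 * of_int a')"
    using prod sb ab(1) \<open>a' \<noteq> 0\<close> unfolding xn by (simp add: field_simps)
  have "a' > 0"
  proof -
    have q: "qconj (1 / (x - of_int n)) = (of_int b' - s) / (2 * of_int a')"
      unfolding eq by (rule qconj_quotient)
    then have "(of_int b' - s) / (2 * of_int a') < 0" using reduced_numberD(4)[OF y] by simp
    then show ?thesis using sb by (simp add: divide_less_0_iff)
  qed
  moreover have "4 * a' dvd N - b'\<^sup>2" unfolding N' by simp
  ultimately show ?thesis using y eq by (auto simp: integral_quotient_def n_def)
qed

text \<open>Finiteness makes two complete quotients coincide. The ratio of their partial products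
  exceeds 1 and maps \<open>lat x\<close> onto itself, so \<open>lat_equivalent_cycle\<close> from
  \<open>x\<close> to \<open>x\<close> gives a return to \<open>x\<close> itself.\<close>

lemma integral_quotient_periodic:
  assumes "integral_quotient x"
  obtains n where "n > 0" "complete_quotient x n = x"
proof -
  have x: "reduced_number x" using assms by (simp add: integral_quotient_def)
  have "integral_quotient (complete_quotient x n)" for n
    by (induction n) (simp_all add: assms integral_quotient_step)
  then have "finite (range (complete_quotient x))"
    by (intro finite_subset[OF _ finite_integral_quotient]) auto
  then have "\<not> inj (complete_quotient x)"
    using finite_imageD infinite_UNIV_nat by blast
  then obtain i j where "i < j" and eq: "complete_quotient x i = complete_quotient x j"
    by (metis injI linorder_neqE_nat)
  let ?p = "cf_prod x i" and ?q = "cf_prod x j"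
  have pos: "?p > 0" "?q > 0" by (rule cf_prod_pos[OF x])+
  have "?p < ?q" using cf_prod_strict_mono[OF x] \<open>i < j\<close> by (simp add: strict_mono_less)
  then have "?q / ?p > 1" using pos by simp
  moreover have "scal ?p (lat x) = scal ?q (lat x)" by (simp only: eq flip: lat_cq[OF x])
  then have "lat x = scal (?q / ?p) (lat x)" by (rule scal_cancel[rotated]) (use pos in simp)
  ultimately show ?thesis using lat_equivalent_cycle[OF x x] that by blast
qed

end

subsection \<open>Units and the regulator\<close>

text \<open>In logarithms, powers of a stabilizing factor become integer multiples, to which
  \<open>add_subgroup_of_int_mult\<close> applies.\<close>

lemma add_subgroup_log_stabilizer: "add_subgroup {d. scal (exp d) A = A}"
proof -
  have "scal (exp (x + y)) A = A" if "scal (exp x) A = A" "scal (exp y) A = A" for x y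
    by (simp only: exp_add that flip: scal_scal)
  moreover have "scal (exp (- x)) A = A" if "scal (exp x) A = A" for x
  proof -
    have "A = scal (1 / exp x) A" by (rule scal_cancel) (simp_all add: that)
    then show ?thesis by (simp add: exp_minus inverse_eq_divide)
  qed
  ultimately show ?thesis by (simp add: add_subgroup_def)
qed

lemma scal_stable_iff:
  assumes "c \<noteq> 0" shows "scal e (scal c A) = scal c A \<longleftrightarrow> scal e A = A"
proof -
  have "scal e (scal c A) = scal c (scal e A)" unfolding scal_scal by (simp add: mult.commute)
  then show ?thesis using inj_image_eq_iff[of "\<lambda>z. c * z"] assms by (auto simp: inj_def)
qed

section \<open>The principal cycle, units and invertible modules\<close>

context real_quadratic_order
begin

lemma principal_form_ex: "\<exists>b c. disc (1, b, c) = N \<and> reduced N (1, b, c)"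
proof -
  define f where "f = \<lfloor>s\<rfloor>"
  have "of_int f \<noteq> s" using s_irrational by (metis Rats_of_int)
  then have f: "of_int f < s" "s < of_int f + 1" unfolding f_def by linarith+
  \<comment> \<open>The largest odd integer below \<open>s\<close>. It lies between
    \<open>s - 2\<close> and \<open>s\<close>, which for leading coefficient 1 and
    \<open>s > 2\<close> is the condition of being reduced.\<close>
  define b where "b = (if odd f then f else f - 1)"
  have "odd b" by (simp add: b_def)
  have b: "of_int b < s" "s - 2 < of_int b" using f by (auto simp: b_def)
  obtain k where k: "b = 2 * k + 1" using \<open>odd b\<close> by (auto elim: oddE)
  obtain l where l: "N = 1 + 4 * l"
    using N_mod by (metis cong_iff_lin cong_sym)
  have "disc (1, b, k\<^sup>2 + k - l) = N" by (simp add: k l power2_eq_square algebra_simps)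
  moreover have "reduced N (1, b, k\<^sup>2 + k - l)" using b s_gt_2 by simp
  ultimately show ?thesis by blast
qed

text \<open>This justifies the definite description in \<open>principal_form\<close>: two odd
  integers in an open interval of length 2 coincide, and the discriminant then fixes the last
  coefficient.\<close>

lemma principal_form:
  obtains b c where "principal_form N = (1, b, c)" "disc (1, b, c) = N" "reduced N (1, b, c)"
proof -
  have uniq: "F = G" if F: "\<exists>b c. F = (1, b, c) \<and> disc F = N \<and> reduced N F"
    and G: "\<exists>b c. G = (1, b, c) \<and> disc G = N \<and> reduced N G" for F G
  proof -
    obtain b c b' c' where F: "F = (1, b, c)" "disc (1, b, c) = N" "reduced N (1, b, c)"
      and G: "G = (1, b', c')" "disc (1, b', c') = N" "reduced N (1, b', c')"
      using F G by blast
    obtain k where k: "b = 2 * k + 1" using odd_middle[OF F(2)] .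
    obtain l where l: "b' = 2 * l + 1" using odd_middle[OF G(2)] .
    have "\<bar>real_of_int b - of_int b'\<bar> < 2" using F(3) G(3) s_gt_2 by auto
    then have "\<bar>b - b'\<bar> < 2" by linarith
    then have "b = b'" using k l by presburger
    then show ?thesis using F G by simp
  qed
  have "\<exists>!F. \<exists>b c. F = (1, b, c) \<and> disc F = N \<and> reduced N F"
    using principal_form_ex uniq by blast
  then have "\<exists>b c. principal_form N = (1, b, c) \<and> disc (principal_form N) = N \<and>
      reduced N (principal_form N)"
    unfolding principal_form_def by (rule theI')
  then show ?thesis using that by metis
qed

abbreviation x0 :: real where "x0 \<equiv> form_term N (principal_form N)"

lemma lat_x0: "lat x0 = ord"
proof -
  obtain b c where p: "principal_form N = (1, b, c)" "disc (1, b, c) = N" by (rule principal_form)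
  obtain k where k: "b = 2 * k + 1" using odd_middle[OF p(2)] .
  show ?thesis unfolding ord_eq[of k] lat_eq_lat2 p(1) by (simp add: k add.commute)
qed

lemma integral_quotient_x0: "integral_quotient x0"
proof -
  obtain b c where p: "principal_form N = (1, b, c)" "disc (1, b, c) = N" "reduced N (1, b, c)"
    by (rule principal_form)
  have "4 * 1 dvd N - b\<^sup>2" using p(2) by auto
  moreover have "reduced_number x0" unfolding p(1) by (rule reduced_number_form_term[OF p(3)])
  ultimately show ?thesis
    unfolding integral_quotient_def p(1) by (intro conjI exI[of _ 1] exI[of _ b]) (simp_all add: add.commute)
qed

lemma reduced_number_x0: "reduced_number x0"
  using integral_quotient_x0 by (simp add: integral_quotient_def)

lemma principal_period: "principal_period N > 0" "complete_quotient x0 (principal_period N) = x0"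
proof -
  have "\<exists>p. p > 0 \<and> complete_quotient x0 p = x0"
    using integral_quotient_periodic[OF integral_quotient_x0] by metis
  then have "principal_period N > 0 \<and> complete_quotient x0 (principal_period N) = x0"
    unfolding principal_period_def by (rule LeastI_ex)
  then show "principal_period N > 0" "complete_quotient x0 (principal_period N) = x0" by auto
qed

lemma exp_regulator: "exp (regulator N) = cf_prod x0 (principal_period N)"
  using cf_prod_pos[OF reduced_number_x0]
  by (simp add: regulator_def cf_distance_eq[of 0])

lemma regulator_pos: "regulator N > 0"
proof -
  have "cf_prod x0 0 < cf_prod x0 (principal_period N)"
    using cf_prod_strict_mono[OF reduced_number_x0] principal_period by (simp only: strict_mono_less)
  then have "exp 0 < exp (regulator N)" by (simp add: exp_regulator)
  then show ?thesis by (simp only: exp_less_cancel_iff)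
qed

lemma regulator_stabilizes: "scal (exp (regulator N)) ord = ord"
  using lat_cq[OF reduced_number_x0, of "principal_period N"]
  by (simp only: principal_period lat_x0 exp_regulator)

text \<open>Division by the regulator leaves a remainder \<open>e\<close> below it that stabilizes
  \<open>ord\<close> as well. A positive \<open>e\<close> would bring the cycle of \<open>x0\<close>
  back to its start at distance \<open>e\<close>, against the minimality of the period.\<close>

lemma stabilizer_multiple_regulator:
  assumes "scal (exp d) ord = ord"
  obtains k where "d = of_int k * regulator N"
proof -
  let ?R = "regulator N"
  define k where "k = \<lfloor>d / ?R\<rfloor>"
  define e where "e = d + of_int (- k) * ?R"
  have "e \<in> {d. scal (exp d) ord = ord}" unfolding e_def
    by (rule add_subgroupD(2)[OF add_subgroup_log_stabilizer _
        add_subgroup_of_int_mult[OF add_subgroup_log_stabilizer]])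
      (use assms regulator_stabilizes in simp_all)
  then have stab: "lat x0 = scal (exp e) (lat x0)" by (simp add: lat_x0)
  have "of_int k \<le> d / ?R" "d / ?R < of_int k + 1" unfolding k_def by linarith+
  then have e: "0 \<le> e" "e < ?R" using regulator_pos by (simp_all add: e_def field_simps)
  have "e = 0"
  proof (rule ccontr)
    assume "e \<noteq> 0"
    then have "exp e > 1" using e by simp
    then obtain n where n: "n > 0" "complete_quotient x0 n = x0" "cf_prod x0 n = exp e"
      using lat_equivalent_cycle[OF reduced_number_x0 reduced_number_x0 stab] by blast
    have "principal_period N \<le> n" unfolding principal_period_def by (rule Least_le) (use n in simp)
    then have "cf_prod x0 (principal_period N) \<le> cf_prod x0 n"
      using cf_prod_strict_mono[OF reduced_number_x0] by (simp only: strict_mono_less_eq)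
    then have "?R \<le> e" by (simp only: n exp_regulator[symmetric] exp_le_cancel_iff)
    then show False using e by simp
  qed
  then show ?thesis using that[of k] by (simp add: e_def)
qed

lemma mulspan_lat_ord:
  assumes "disc F = N" "reduced N F"
  shows "mulspan (lat (form_term N F)) ord = lat (form_term N F)"
proof -
  obtain a b c where F: "F = (a, b, c)" by (metis prod_cases3)
  have a: "a \<noteq> 0" using assms(2) reduced_lead_nonzero unfolding F by blast
  have "lat (form_term N F) = scal (1 / of_int \<bar>a\<bar>) (form_ideal N F)"
    unfolding F by (rule scal_cancel) (use a form_ideal_eq_lat[OF a] in simp_all)
  then show ?thesis
    using assms(1) by (simp only: mulspan_scal_left mulspan_ideal_ord F)
qed

lemma mulspan_ord_ord: "mulspan ord ord = ord"
proof -
  obtain b c where p: "principal_form N = (1, b, c)" "disc (1, b, c) = N" "reduced N (1, b, c)"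
    by (rule principal_form)
  show ?thesis using mulspan_lat_ord[OF p(2,3)] by (simp only: lat_x0 p(1)[symmetric])
qed

text \<open>The conjugate ideal, suitably rescaled, is an inverse up to the factor
  \<open>a\<close>.\<close>

lemma lat_invertible:
  assumes "disc F = N" "reduced N F" "primitive_form F"
  obtains B c where "c \<noteq> 0" "mulspan (lat (form_term N F)) B = scal c ord"
proof -
  obtain a b c where F: "F = (a, b, c)" by (metis prod_cases3)
  have a: "a \<noteq> 0" using assms(2) reduced_lead_nonzero unfolding F by blast
  have "mulspan (lat (form_term N F)) (scal (of_int \<bar>a\<bar>) (form_ideal N (a, - b, c))) =
      mulspan (form_ideal N F) (form_ideal N (a, - b, c))"
    unfolding F form_ideal_eq_lat[OF a] by (simp only: mulspan_scal_left mulspan_scal_right)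
  also have "\<dots> = scal (of_int a) ord"
    using assms mulspan_ideal_conj unfolding F by blast
  finally show ?thesis using that a by (metis of_int_eq_0_iff)
qed

text \<open>Multiplication by inverses of both factors turns \<open>Y\<close> into a multiple of
  \<open>ord\<close> and carries the stabilizing factor along. Conversely, \<open>Y\<close> absorbs
  the factor \<open>ord\<close>.\<close>

lemma stabilizer_product:
  assumes F: "disc F = N" "reduced N F" "primitive_form F"
    and G: "disc G = N" "reduced N G" "primitive_form G"
  defines "Y \<equiv> mulspan (lat (form_term N F)) (lat (form_term N G))"
  shows "scal e Y = Y \<longleftrightarrow> scal e ord = ord"
proof
  assume e: "scal e Y = Y"
  obtain B c where B: "c \<noteq> 0" "mulspan (lat (form_term N F)) B = scal c ord"
    using lat_invertible[OF F] .
  obtain B' c' where B': "c' \<noteq> 0" "mulspan (lat (form_term N G)) B' = scal c' ord"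
    using lat_invertible[OF G] .
  have "mulspan Y (mulspan B B') =
      mulspan (mulspan (lat (form_term N F)) B) (mulspan (lat (form_term N G)) B')"
    unfolding Y_def by (metis mulspan_assoc mulspan_commute)
  also have "\<dots> = scal (c' * c) ord"
    by (simp only: B B' mulspan_scal_left mulspan_scal_right mulspan_ord_ord scal_scal)
  finally have Z: "mulspan Y (mulspan B B') = scal (c' * c) ord" .
  have "scal e (scal (c' * c) ord) = scal (c' * c) ord"
    by (simp only: Z[symmetric] mulspan_scal_left[symmetric] e)
  then show "scal e ord = ord" using B B' scal_stable_iff[of "c' * c"] by simp
next
  assume e: "scal e ord = ord"
  have Y: "Y = mulspan ord Y"
    unfolding Y_def by (metis mulspan_assoc mulspan_commute mulspan_lat_ord[OF F(1,2)])
  then have "scal e Y = mulspan (scal e ord) Y" by (simp only: mulspan_scal_left)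
  then show "scal e Y = Y" using Y by (simp only: e)
qed

lemma comp_factor_pos: "a1 \<noteq> 0 \<Longrightarrow> comp_factor (a1, b1, c1) G > 0"
  by (cases G) simp

text \<open>In \<open>composition_ideal\<close> the leading coefficients are divided out; what is
  left of them is a single factor \<open>m\<close>, because
  \<open>A * m\<^sup>2 = a1 * a2\<close>.\<close>

lemma composition_lat:
  assumes F: "disc F = N" "reduced N F" "primitive_form F" and G: "disc G = N" "reduced N G"
    and comp: "is_composition N F G (A, B, C)"
  shows "A \<noteq> 0" and "comp_factor F G > 0"
    and "lat (form_term N (A, B, C)) =
      scal (of_int (comp_factor F G)) (mulspan (lat (form_term N F)) (lat (form_term N G)))"
proof -
  obtain a1 b1 c1 where f: "F = (a1, b1, c1)" by (metis prod_cases3)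
  obtain a2 b2 c2 where g: "G = (a2, b2, c2)" by (metis prod_cases3)
  have a: "a1 \<noteq> 0" "a2 \<noteq> 0" using F(2) G(2) reduced_lead_nonzero unfolding f g by blast+
  define m where "m = comp_factor F G"
  show "comp_factor F G > 0" unfolding f by (rule comp_factor_pos[OF a(1)])
  then have m: "m > 0" by (simp add: m_def)
  note comp_ideal = composition_ideal[OF F(1)[unfolded f] G(1)[unfolded g] F(3)[unfolded f] a
      comp[unfolded f g], folded f g, folded m_def]
  show A: "A \<noteq> 0" using comp_ideal(2) a by auto
  let ?Y = "mulspan (lat (form_term N F)) (lat (form_term N G))"
  have "scal (of_int m * of_int \<bar>A\<bar>) (lat (form_term N (A, B, C))) =
      scal (of_int m) (form_ideal N (A, B, C))"
    by (simp only: form_ideal_eq_lat[OF A] scal_scal)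
  also have "\<dots> = scal (of_int \<bar>a1\<bar> * of_int \<bar>a2\<bar>) ?Y"
    unfolding comp_ideal(1)[symmetric] unfolding f g form_ideal_eq_lat[OF a(1)] form_ideal_eq_lat[OF a(2)]
    unfolding mulspan_scal_left mulspan_scal_right scal_scal by (subst mult.commute) (rule refl)
  finally have "lat (form_term N (A, B, C)) =
      scal (of_int \<bar>a1\<bar> * of_int \<bar>a2\<bar> / (of_int m * of_int \<bar>A\<bar>)) ?Y"
    by (rule scal_cancel[rotated]) (use A m in simp)
  moreover have "real_of_int \<bar>a1\<bar> * of_int \<bar>a2\<bar> / (of_int m * of_int \<bar>A\<bar>) = of_int m"
  proof -
    have "\<bar>a1\<bar> * \<bar>a2\<bar> = m * (m * \<bar>A\<bar>)"
      using comp_ideal(2) m by (metis abs_mult abs_of_pos mult.assoc mult.commute power2_eq_square)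
    then have "real_of_int \<bar>a1\<bar> * of_int \<bar>a2\<bar> = of_int m * (of_int m * of_int \<bar>A\<bar>)"
      by (metis of_int_mult)
    then show ?thesis using A m by simp
  qed
  ultimately show "lat (form_term N (A, B, C)) = scal (of_int (comp_factor F G)) ?Y"
    by (simp only: m_def)
qed

end

text \<open>Since \<open>is_distance\<close> is a relation, the formula is asserted for each of its
  values; the existence of a value keeps this from being vacuous.\<close>

theorem theorem2p10:
  fixes N :: int
    and F1 Fk G1 Gl C1 C2 H1 H2 :: form
    and dF dG r1 r2 :: real
  assumes "N > 0" and "[N = 1] (mod 4)" and "\<not> is_square N"
    and "disc F1 = N" and "disc Fk = N" and "disc G1 = N" and "disc Gl = N"
    and "reduced N F1" and "reduced N Fk" and "reduced N G1" and "reduced N Gl"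
    and "primitive_form F1" and "primitive_form G1"
    and "properly_equivalent F1 Fk" and "properly_equivalent G1 Gl"
    and "is_composition N F1 G1 C1" and "reduces_to N C1 H1"
    and "is_composition N Fk Gl C2" and "reduces_to N C2 H2"
    and "is_distance N F1 Fk dF" and "is_distance N G1 Gl dG"
    and "is_reduction_distance (form_ideal N C1) (form_ideal N H1) r1"
    and "is_reduction_distance (form_ideal N C2) (form_ideal N H2) r2"
  shows "(\<exists>d. is_distance N H1 H2 d) \<and>
         (\<forall>d. is_distance N H1 H2 d \<longrightarrow>
            [d = dF + dG + r2 - r1 + ln (of_int (comp_factor Fk Gl) / of_int (comp_factor F1 G1))]
              (rmod (regulator N)))"
proof -
  interpret real_quadratic_order N
    by unfold_locales (use assms in auto)
  let ?L = "\<lambda>F. lat (form_term N F)"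
  define Y where "Y = mulspan (?L F1) (?L G1)"
  define m1 m2 where "m1 = comp_factor F1 G1" and "m2 = comp_factor Fk Gl"
  have Fk: "primitive_form Fk"
    using primitive_form_properly_equivalent assms by blast
  obtain A1 B1 D1 where C1: "C1 = (A1, B1, D1)" by (metis prod_cases3)
  obtain A2 B2 D2 where C2: "C2 = (A2, B2, D2)" by (metis prod_cases3)
  obtain a1 b1 d1 where H1: "H1 = (a1, b1, d1)" by (metis prod_cases3)
  obtain a2 b2 d2 where H2: "H2 = (a2, b2, d2)" by (metis prod_cases3)
  have red: "reduced N H1" "reduced N H2" using assms reduces_to_reduced by blast+
  then have nz: "a1 \<noteq> 0" "a2 \<noteq> 0" using reduced_lead_nonzero unfolding H1 H2 by blast+
  note comp1 = composition_lat[OF \<open>disc F1 = N\<close> \<open>reduced N F1\<close> \<open>primitive_form F1\<close>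
      \<open>disc G1 = N\<close> \<open>reduced N G1\<close> \<open>is_composition N F1 G1 C1\<close>[unfolded C1], folded C1 m1_def Y_def]
  note comp2 = composition_lat[OF \<open>disc Fk = N\<close> \<open>reduced N Fk\<close> Fk
      \<open>disc Gl = N\<close> \<open>reduced N Gl\<close> \<open>is_composition N Fk Gl C2\<close>[unfolded C2], folded C2 m2_def]
  have "?L Fk = scal (exp dF) (?L F1)" "?L Gl = scal (exp dG) (?L G1)"
    using distance_lat assms by auto
  then have "?L C2 = scal (of_int m2 * (exp dG * exp dF)) Y"
    unfolding comp2(3) by (simp only: mulspan_scal_left mulspan_scal_right scal_scal Y_def)
  moreover have "?L H1 = scal (exp r1) (?L C1)"
    using reduction_distance_lat[OF assms(22)[unfolded C1 H1] comp1(1) nz(1)] by (simp only: C1 H1)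
  moreover have "?L H2 = scal (exp r2) (?L C2)"
    using reduction_distance_lat[OF assms(23)[unfolded C2 H2] comp2(1) nz(2)] by (simp only: C2 H2)
  ultimately have L1: "?L H1 = scal (exp r1 * of_int m1) Y"
    and L2: "?L H2 = scal (exp r2 * (of_int m2 * (exp dG * exp dF))) Y"
    by (simp_all only: comp1(3) scal_scal)
  define D where "D = dF + dG + r2 - r1 + ln (of_int m2 / of_int m1)"
  \<comment> \<open>The logarithm in \<open>D\<close> turns into \<open>m2 / m1\<close>, so
    \<open>exp D\<close> is the ratio of the factors in \<open>L2\<close> and
    \<open>L1\<close>.\<close>
  have "exp D * (exp r1 * of_int m1) = exp r2 * (of_int m2 * (exp dG * exp dF))"
    using comp1(2) comp2(2) by (simp add: D_def exp_add exp_diff)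
  then have LD: "?L H2 = scal (exp D) (?L H1)"
    by (simp only: L1 L2 scal_scal)
  have stab: "scal e (?L H1) = ?L H1 \<longleftrightarrow> scal e ord = ord" for e
    unfolding L1 using comp1(2) scal_stable_iff[of "exp r1 * of_int m1" e Y]
      stabilizer_product[of F1 G1 e, folded Y_def] assms by simp
  have "is_distance N H1 H2 d \<Longrightarrow> [d = D] (rmod (regulator N))" for d
  proof -
    assume "is_distance N H1 H2 d"
    then have "scal (exp d) (?L H1) = scal (exp D) (?L H1)"
      using distance_lat[OF _ red(1)] LD by simp
    then have "?L H1 = scal (exp D / exp d) (?L H1)"
      by (rule scal_cancel[rotated]) simp
    \<comment> \<open>A factor fixing the module of \<open>H1\<close> fixes the order, so
      \<open>exp (D - d)\<close> is a unit.\<close>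
    then have "scal (exp (D - d)) ord = ord" by (simp only: exp_diff stab[symmetric])
    then obtain k where "D - d = of_int k * regulator N"
      by (rule stabilizer_multiple_regulator)
    then show ?thesis unfolding rcong_altdef by (intro exI[of _ k]) simp
  qed
  moreover have "\<exists>d. is_distance N H1 H2 d"
  proof -
    let ?R = "regulator N"
    \<comment> \<open>Adding enough regulators to \<open>D\<close> makes the scaling factor exceed
      1, as \<open>lat_equivalent_cycle\<close> demands, and does not change its effect on the
      module.\<close>
    define k where "k = \<lfloor>- D / ?R\<rfloor> + 1"
    have "of_int k > - D / ?R" unfolding k_def by linarith
    then have pos: "D + of_int k * ?R > 0" using regulator_pos by (simp add: field_simps)
    have "scal (exp (of_int k * ?R)) ord = ord"
      using add_subgroup_of_int_mult[OF add_subgroup_log_stabilizer, of ?R ord k]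
        regulator_stabilizes by simp
    then have kR: "scal (exp (of_int k * ?R)) (?L H1) = ?L H1" by (simp only: stab)
    have "?L H2 = scal (exp D) (scal (exp (of_int k * ?R)) (?L H1))" by (simp only: LD kR)
    then have "?L H2 = scal (exp (D + of_int k * ?R)) (?L H1)"
      by (simp only: scal_scal exp_add)
    then obtain n where "n > 0" "complete_quotient (form_term N H1) n = form_term N H2"
      using lat_equivalent_cycle[OF reduced_number_form_term[OF red(1)]
          reduced_number_form_term[OF red(2)]] pos by (metis one_less_exp_iff)
    then show ?thesis using is_distance_cf_prod by blast
  qed
  ultimately show ?thesis unfolding D_def m1_def m2_def by blast
qed

end
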